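(* Let $A$ be a $1$-finite cdga, let $\mathfrak{g}$ be a finite-dimensional Lie algebra, and let $\theta\colon\mathfrak{g}\to\mathfrak{gl}(V)$ be a finite-dimensional representation with $V\neq 0$. Let $\omega=\eta\otimes g$ (with $\eta\in A^1$, $d\eta=0$, $g\in\mathfrak{g}$) be an arbitrary element of $\mathcal{F}^1(A,\mathfrak{g})$. Then, for each $k\ge 0$, $\omega$ belongs to $\mathcal{R}^k_1(A,\theta)$ if and only if there is an eigenvalue $\lambda$ of $\theta(g)$ such that $\lambda\eta$ belongs to $\mathcal{R}^k_1(A)$. Moreover, $$\Pi(A,\theta)\subseteq\bigcap_{k:\,H^k(A)\ne 0}\mathcal{R}^k_1(A,\theta).$$
   Context: Everything is over $\mathbb{C}$. A cdga is a (graded-)commutative, non-negatively graded differential graded algebra $A=(A^\bullet,d)$; it is connected if $A^0=\mathbb{C}\cdot 1$, and $1$-finite if it is connected and $A^1$ is finite-dimensional. For a Lie algebra $\mathfrak{g}$, $A\otimes\mathfrak{g}$ has Lie bracket $[\alpha\otimes x,\beta\otimes y]=\alpha\beta\otimes[x,y]$ and differential $\partial(\alpha\otimes x)=d\alpha\otimes x$. The set of $\mathfrak{g}$-valued flat connections is $$\mathcal{F}(A,\mathfrak{g})=\{\omega\in A^1\otimes\mathfrak{g}\mid \partial\omega+\tfrac12[\omega,\omega]=0\}.$$ For a representation $\theta\colon\mathfrak{g}\to\mathfrak{gl}(V)$ and $\omega=\sum_i\eta_i\otimes g_i\in\mathcal{F}(A,\mathfrak{g})$, $A\otimes V$ is a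 cochain complex with differential $d_\omega(\alpha\otimes v)=d\alpha\otimes v+\sum_i\eta_i\alpha\otimes\theta(g_i)v$, and $$\mathcal{R}^i_r(A,\theta)=\{\omega\in\mathcal{F}(A,\mathfrak{g})\mid\dim_{\mathbb{C}}H^i(A\otimes V,d_\omega)\ge r\}.$$ In the rank one case $\mathfrak{g}=\mathbb{C}$, $\theta=\mathrm{id}_{\mathbb{C}}$, one has $\mathcal{F}(A,\mathbb{C})=\{\alpha\in A^1\mid d\alpha=0\}=H^1(A)$ and $\mathcal{R}^i_r(A):=\mathcal{R}^i_r(A,\mathrm{id}_{\mathbb{C}})\subseteq H^1(A)$. $\mathcal{F}^1(A,\mathfrak{g})\subseteq\mathcal{F}(A,\mathfrak{g})$ is the set of all tensors of the form $\eta\otimes g$ with $\eta\in A^1$, $d\eta=0$, $g\in\mathfrak{g}$. $\Pi(A,\theta)\subseteq\mathcal{F}^1(A,\mathfrak{g})$ is the set of all tensors $\eta\otimes g$ with $d\eta=0$ and $\det(\theta(g))=0$. *)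

theory Defs
  imports
    Complex_Main
    "HOL-Library.Extended_Nat"
    "HOL-Library.Poly_Mapping"
    "Jordan_Normal_Form.Determinant"
begin

section \<open>Complex vector spaces and algebras\<close>

text \<open>The complex analogues of the classes \<^class>\<open>real_vector\<close> and \<^class>\<open>real_algebra_1\<close>.
  The unit of a \<open>complex_algebra_1\<close> is different from \<open>0\<close>.\<close>

class complex_vector = ab_group_add +
  fixes scaleC :: "complex \<Rightarrow> 'a \<Rightarrow> 'a" (infixr \<open>*\<^sub>C\<close> 75)
  assumes scaleC_add_right: "a *\<^sub>C (x + y) = a *\<^sub>C x + a *\<^sub>C y"
    and scaleC_add_left: "(a + b) *\<^sub>C x = a *\<^sub>C x + b *\<^sub>C x"
    and scaleC_scaleC: "a *\<^sub>C b *\<^sub>C x = (a * b) *\<^sub>C x"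
    and scaleC_one: "1 *\<^sub>C x = x"

class complex_algebra_1 = complex_vector + ring_1 +
  assumes mult_scaleC_left: "a *\<^sub>C x * y = a *\<^sub>C (x * y)"
    and mult_scaleC_right: "x * a *\<^sub>C y = a *\<^sub>C (x * y)"

instantiation complex :: complex_algebra_1
begin
definition scaleC_complex :: "complex \<Rightarrow> complex \<Rightarrow> complex"
  where "scaleC_complex a x = a * x"
instance by standard (auto simp: scaleC_complex_def algebra_simps)
end

global_interpretation complex_vector:
  vector_space "scaleC :: complex \<Rightarrow> 'a \<Rightarrow> 'a::complex_vector"
  defines cdependent = complex_vector.dependent
    and crepresentation = complex_vector.representation
    and csubspace = complex_vector.subspace
    and cspan = complex_vector.span
  by standard (simp_all add: scaleC_add_right scaleC_add_left scaleC_scaleC scaleC_one)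

abbreviation clinear :: "('a::complex_vector \<Rightarrow> 'b::complex_vector) \<Rightarrow> bool"
  where "clinear \<equiv> Vector_Spaces.linear scaleC scaleC"

definition cbilinear ::
    "('a::complex_vector \<Rightarrow> 'b::complex_vector \<Rightarrow> 'c::complex_vector) \<Rightarrow> bool"
  where "cbilinear f \<longleftrightarrow> (\<forall>y. clinear (\<lambda>x. f x y)) \<and> (\<forall>x. clinear (f x))"

definition finite_dim :: "'a::complex_vector set \<Rightarrow> bool"
  where "finite_dim S \<longleftrightarrow> (\<exists>B. finite B \<and> cspan B = S)"

lemma clinearI:
  assumes "\<And>x y. f (x + y) = f x + f y" "\<And>c x. f (c *\<^sub>C x) = c *\<^sub>C f x"
  shows "clinear f"
  by unfold_locales (use assms in auto)

lemma clinearD: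
  assumes "clinear f"
  shows "f (x + y) = f x + f y" "f (c *\<^sub>C x) = c *\<^sub>C f x" "f 0 = 0" "f (x - y) = f x - f y"
proof -
  interpret Vector_Spaces.linear scaleC scaleC f by fact
  show "f (x + y) = f x + f y" "f (c *\<^sub>C x) = c *\<^sub>C f x" "f 0 = 0" "f (x - y) = f x - f y"
    by (simp_all add: add scale diff)
qed

lemma clinear_sum: "clinear f \<Longrightarrow> f (\<Sum>i\<in>I. x i) = (\<Sum>i\<in>I. f (x i))"
  by (induction I rule: infinite_finite_induct) (simp_all add: clinearD)

lemma cbilinearI:
  assumes "\<And>x x' y. f (x + x') y = f x y + f x' y" "\<And>c x y. f (c *\<^sub>C x) y = c *\<^sub>C f x y"
    "\<And>x y y'. f x (y + y') = f x y + f x y'" "\<And>c x y. f x (c *\<^sub>C y) = c *\<^sub>C f x y"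
  shows "cbilinear f"
  unfolding cbilinear_def using assms by (auto intro!: clinearI)

lemma cbilinearD:
  assumes "cbilinear f"
  shows "f (x + x') y = f x y + f x' y" "f (c *\<^sub>C x) y = c *\<^sub>C f x y"
    "f x (y + y') = f x y + f x y'" "f x (c *\<^sub>C y) = c *\<^sub>C f x y"
  using assms clinearD(1,2)[of "\<lambda>x. f x y"] clinearD(1,2)[of "f x"]
  unfolding cbilinear_def by auto


section \<open>Endomorphisms of a finite-dimensional space\<close>

definition endo_eigenvalue :: "('v::complex_vector \<Rightarrow> 'v) \<Rightarrow> complex \<Rightarrow> bool"
  where "endo_eigenvalue f c \<longleftrightarrow> (\<exists>v. v \<noteq> 0 \<and> f v = c *\<^sub>C v)"

definition ordered_basis :: "'v::complex_vector list \<Rightarrow> bool"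
  where "ordered_basis bs \<longleftrightarrow> distinct bs \<and> \<not> cdependent (set bs) \<and> cspan (set bs) = UNIV"

definition endo_matrix :: "'v::complex_vector list \<Rightarrow> ('v \<Rightarrow> 'v) \<Rightarrow> complex mat"
  where "endo_matrix bs f =
    mat (length bs) (length bs) (\<lambda>(i, j). crepresentation (set bs) (f (bs ! j)) (bs ! i))"

text \<open>The determinant of an endomorphism does not depend on the basis; it is meaningful only
  if the space is finite-dimensional.\<close>

definition endo_det :: "('v::complex_vector \<Rightarrow> 'v) \<Rightarrow> complex"
  where "endo_det f = det (endo_matrix (SOME bs. ordered_basis bs) f)"


section \<open>Tensor products\<close>

instantiation poly_mapping :: (type, complex_vector) complex_vector
begin
lift_definition scaleC_poly_mapping :: "complex \<Rightarrow> ('a \<Rightarrow>\<^sub>0 'b) \<Rightarrow> ('a \<Rightarrow>\<^sub>0 'b)"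
  is "\<lambda>c f k. c *\<^sub>C f k"
  by (auto elim!: finite_subset[rotated])
instance
  by standard (transfer; simp add: scaleC_add_right scaleC_add_left scaleC_scaleC scaleC_one)+
end

text \<open>\<open>A \<otimes> V\<close> is the free vector space on \<open>A \<times> V\<close> modulo the subspace generated by the
  bilinearity relations.\<close>

abbreviation free_gen :: "'a \<Rightarrow> 'b \<Rightarrow> ('a \<times> 'b \<Rightarrow>\<^sub>0 complex)"
  where "free_gen a b \<equiv> Poly_Mapping.single (a, b) 1"

definition tensor_rels :: "('a::complex_vector \<times> 'b::complex_vector \<Rightarrow>\<^sub>0 complex) set"
  where "tensor_rels =
      {free_gen (a + a') b - free_gen a b - free_gen a' b | a a' b. True}
    \<union> {free_gen a (b + b') - free_gen a b - free_gen a b' | a b b'. True}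
    \<union> {free_gen (c *\<^sub>C a) b - c *\<^sub>C free_gen a b | c a b. True}
    \<union> {free_gen a (c *\<^sub>C b) - c *\<^sub>C free_gen a b | c a b. True}"

quotient_type (overloaded) ('a, 'b) tensor =
  "('a::complex_vector \<times> 'b::complex_vector) \<Rightarrow>\<^sub>0 complex"
  / "\<lambda>x y. x - y \<in> cspan tensor_rels"
proof (rule equivpI)
  show "reflp (\<lambda>x y :: ('a \<times> 'b) \<Rightarrow>\<^sub>0 complex. x - y \<in> cspan tensor_rels)"
    by (rule reflpI) (simp add: complex_vector.span_zero)
  show "symp (\<lambda>x y :: ('a \<times> 'b) \<Rightarrow>\<^sub>0 complex. x - y \<in> cspan tensor_rels)"
  proof (rule sympI)
    fix x y :: "('a \<times> 'b) \<Rightarrow>\<^sub>0 complex"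
    assume "x - y \<in> cspan tensor_rels"
    from complex_vector.span_neg[OF this] show "y - x \<in> cspan tensor_rels" by simp
  qed
  show "transp (\<lambda>x y :: ('a \<times> 'b) \<Rightarrow>\<^sub>0 complex. x - y \<in> cspan tensor_rels)"
  proof (rule transpI)
    fix x y z :: "('a \<times> 'b) \<Rightarrow>\<^sub>0 complex"
    assume "x - y \<in> cspan tensor_rels" "y - z \<in> cspan tensor_rels"
    from complex_vector.span_add[OF this] show "x - z \<in> cspan tensor_rels" by simp
  qed
qed

instantiation tensor :: (complex_vector, complex_vector) complex_vector
begin
lift_definition zero_tensor :: "('a, 'b) tensor" is 0 .
lift_definition plus_tensor :: "('a, 'b) tensor \<Rightarrow> ('a, 'b) tensor \<Rightarrow> ('a, 'b) tensor" is "(+)"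
  subgoal premises prems for x x' y y'
    using complex_vector.span_add[OF prems] by (simp only: add_diff_add)
  done
lift_definition uminus_tensor :: "('a, 'b) tensor \<Rightarrow> ('a, 'b) tensor" is uminus
  subgoal premises prems for x x'
    using complex_vector.span_neg[OF prems] by (simp only: minus_diff_minus)
  done
lift_definition minus_tensor :: "('a, 'b) tensor \<Rightarrow> ('a, 'b) tensor \<Rightarrow> ('a, 'b) tensor" is "(-)"
  subgoal premises prems for x x' y y'
  proof -
    have "(x - y) - (x' - y') = (x - x') - (y - y')" by simp
    with complex_vector.span_diff[OF prems] show ?thesis by (simp only:)
  qed
  done
lift_definition scaleC_tensor :: "complex \<Rightarrow> ('a, 'b) tensor \<Rightarrow> ('a, 'b) tensor" is "scaleC"
  subgoal premises prems for c x x'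
    using complex_vector.span_scale[OF prems, of c]
    by (simp only: complex_vector.scale_right_diff_distrib)
  done
instance
proof
  fix x y z :: "('a, 'b) tensor" and a b :: complex
  show "x + y + z = x + (y + z)"
    by transfer (simp add: add.assoc complex_vector.span_zero)
  show "x + y = y + x"
    by transfer (simp add: add.commute complex_vector.span_zero)
  show "0 + x = x"
    by transfer (simp add: complex_vector.span_zero)
  show "- x + x = 0"
    by transfer (simp add: complex_vector.span_zero)
  show "x - y = x + - y"
    by transfer (simp add: complex_vector.span_zero)
  show "a *\<^sub>C (x + y) = a *\<^sub>C x + a *\<^sub>C y"
    by transfer (simp add: scaleC_add_right complex_vector.span_zero)
  show "(a + b) *\<^sub>C x = a *\<^sub>C x + b *\<^sub>C x"
    by transfer (simp add: scaleC_add_left complex_vector.span_zero)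
  show "a *\<^sub>C b *\<^sub>C x = (a * b) *\<^sub>C x"
    by transfer (simp add: scaleC_scaleC complex_vector.span_zero)
  show "1 *\<^sub>C x = x"
    by transfer (simp add: scaleC_one complex_vector.span_zero)
qed
end

lift_definition pure_tensor :: "'a::complex_vector \<Rightarrow> 'b::complex_vector \<Rightarrow> ('a, 'b) tensor"
    (infixr \<open>\<otimes>\<^sub>C\<close> 76)
  is free_gen .

text \<open>\<open>tensor_lift f\<close> is the linear map on the tensor product induced by a bilinear map \<open>f\<close>
  (it is a junk value otherwise).\<close>

definition free_ext :: "('x \<Rightarrow> 'c::complex_vector) \<Rightarrow> ('x \<Rightarrow>\<^sub>0 complex) \<Rightarrow> 'c"
  where "free_ext f p = (\<Sum>x\<in>Poly_Mapping.keys p. Poly_Mapping.lookup p x *\<^sub>C f x)"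

definition tensor_lift ::
    "('a::complex_vector \<Rightarrow> 'b::complex_vector \<Rightarrow> 'c::complex_vector) \<Rightarrow> ('a, 'b) tensor \<Rightarrow> 'c"
  where "tensor_lift f t = free_ext (\<lambda>(a, b). f a b) (rep_tensor t)"

lemma tensor_relsI:
  "free_gen (a + a') b - free_gen a b - free_gen a' b \<in> tensor_rels"
  "free_gen a (b + b') - free_gen a b - free_gen a b' \<in> tensor_rels"
  "free_gen (c *\<^sub>C a) b - c *\<^sub>C free_gen a b \<in> tensor_rels"
  "free_gen a (c *\<^sub>C b) - c *\<^sub>C free_gen a b \<in> tensor_rels"
  unfolding tensor_rels_def Un_iff mem_Collect_eq by metis+

lemma cbilinear_pure_tensor: "cbilinear (\<otimes>\<^sub>C)"
proof (rule cbilinearI)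
  note rels = tensor_relsI[THEN complex_vector.span_base]
  fix x x' :: 'a and y y' :: 'b and c :: complex
  show "(x + x') \<otimes>\<^sub>C y = x \<otimes>\<^sub>C y + x' \<otimes>\<^sub>C y"
    by transfer (rule rels(1)[unfolded diff_diff_add])
  show "(c *\<^sub>C x) \<otimes>\<^sub>C y = c *\<^sub>C (x \<otimes>\<^sub>C y)"
    by transfer (rule rels(3))
  show "x \<otimes>\<^sub>C (y + y') = x \<otimes>\<^sub>C y + x \<otimes>\<^sub>C y'"
    by transfer (rule rels(2)[unfolded diff_diff_add])
  show "x \<otimes>\<^sub>C (c *\<^sub>C y) = c *\<^sub>C (x \<otimes>\<^sub>C y)"
    by transfer (rule rels(4))
qed

lemma free_ext_superset:
  assumes "finite S" "Poly_Mapping.keys p \<subseteq> S"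
  shows "free_ext f p = (\<Sum>x\<in>S. Poly_Mapping.lookup p x *\<^sub>C f x)"
  unfolding free_ext_def
  by (rule sum.mono_neutral_left) (use assms in \<open>auto simp: in_keys_iff\<close>)

lemma clinear_free_ext: "clinear (free_ext f)"
proof (rule clinearI)
  fix p q :: "'a \<Rightarrow>\<^sub>0 complex" and c :: complex
  let ?S = "Poly_Mapping.keys p \<union> Poly_Mapping.keys q"
  have "Poly_Mapping.keys (p + q) \<subseteq> ?S" by (rule Poly_Mapping.keys_add)
  then show "free_ext f (p + q) = free_ext f p + free_ext f q"
    by (simp add: free_ext_superset[where S = ?S] lookup_add scaleC_add_left sum.distrib)
  have "Poly_Mapping.keys (c *\<^sub>C p) \<subseteq> Poly_Mapping.keys p"
    by (auto simp: in_keys_iff scaleC_poly_mapping.rep_eq)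
  then show "free_ext f (c *\<^sub>C p) = c *\<^sub>C free_ext f p"
    by (simp add: free_ext_superset[where S = "Poly_Mapping.keys p"] scaleC_poly_mapping.rep_eq
        complex_vector.scale_sum_right scaleC_scaleC scaleC_complex_def)
qed

lemma free_ext_single: "free_ext f (Poly_Mapping.single x 1) = f x"
  by (simp add: free_ext_def scaleC_one)

lemma free_ext_rels:
  assumes "cbilinear f" "p \<in> cspan tensor_rels"
  shows "free_ext (\<lambda>(a, b). f a b) p = 0"
  using assms(2)
proof (induction rule: complex_vector.span_induct_alt)
  case base
  show ?case by (rule clinearD(3)[OF clinear_free_ext])
next
  case (step c p q)
  note simps = clinearD(2,4)[OF clinear_free_ext] free_ext_single prod.case
  from step(1) have "free_ext (\<lambda>(a, b). f a b) p = 0"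
    unfolding tensor_rels_def Un_iff mem_Collect_eq
    by (elim disjE exE conjE) (simp_all only: simps cbilinearD[OF assms(1)]
        add_diff_cancel_left' diff_self)
  with step(2) show ?case by (simp add: clinearD(1,2)[OF clinear_free_ext])
qed

lemma tensor_lift_abs:
  assumes "cbilinear f"
  shows "tensor_lift f (abs_tensor p) = free_ext (\<lambda>(a, b). f a b) p"
proof -
  have "rep_tensor (abs_tensor p) - p \<in> cspan tensor_rels"
    by (rule Quotient3_rep_abs[OF Quotient3_tensor]) (simp add: complex_vector.span_zero)
  from free_ext_rels[OF assms this] show ?thesis
    by (simp add: tensor_lift_def clinearD(4)[OF clinear_free_ext])
qed

lemma tensor_lift_pure: "cbilinear f \<Longrightarrow> tensor_lift f (a \<otimes>\<^sub>C b) = f a b"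
  by (simp add: pure_tensor.abs_eq tensor_lift_abs free_ext_single)

lemma clinear_tensor_lift:
  assumes "cbilinear f" shows "clinear (tensor_lift f)"
proof (rule clinearI)
  fix x y :: "('a, 'b) tensor" and c
  show "tensor_lift f (x + y) = tensor_lift f x + tensor_lift f y"
    by (induct x rule: tensor.abs_induct; induct y rule: tensor.abs_induct)
       (simp add: plus_tensor.abs_eq tensor_lift_abs[OF assms] clinearD(1)[OF clinear_free_ext])
  show "tensor_lift f (c *\<^sub>C x) = c *\<^sub>C tensor_lift f x"
    by (induct x rule: tensor.abs_induct)
       (simp add: scaleC_tensor.abs_eq tensor_lift_abs[OF assms] clinearD(2)[OF clinear_free_ext])
qed

lemma span_pure_tensors:
  "cspan {a \<otimes>\<^sub>C b | a b. True} = (UNIV :: ('a::complex_vector, 'b::complex_vector) tensor set)"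
proof -
  have "abs_tensor p \<in> cspan {a \<otimes>\<^sub>C b | a b. True}" for p :: "'a \<times> 'b \<Rightarrow>\<^sub>0 complex"
  proof (induction p rule: update_induct)
    case const
    show ?case
      using complex_vector.span_zero by (simp add: zero_tensor.abs_eq[symmetric])
  next
    case (update p k c)
    have "Poly_Mapping.update k c p = p + c *\<^sub>C free_gen (fst k) (snd k)"
      by (rule poly_mapping_eqI)
         (use update(1) in \<open>auto simp: lookup_update lookup_add scaleC_poly_mapping.rep_eq
           lookup_single scaleC_complex_def in_keys_iff when_def\<close>)
    then have "abs_tensor (Poly_Mapping.update k c p) = abs_tensor p + c *\<^sub>C (fst k \<otimes>\<^sub>C snd k)"
      by (simp only: pure_tensor.abs_eq scaleC_tensor.abs_eq plus_tensor.abs_eq)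
    moreover have "fst k \<otimes>\<^sub>C snd k \<in> cspan {a \<otimes>\<^sub>C b | a b. True}"
      by (rule complex_vector.span_base) blast
    ultimately show ?case
      using update(3) by (simp only: complex_vector.span_add complex_vector.span_scale)
  qed
  then show ?thesis
    using tensor.abs_induct[of "\<lambda>t. t \<in> cspan {a \<otimes>\<^sub>C b | a b. True}"] by blast
qed


section \<open>Commutative differential graded algebras\<close>

text \<open>\<open>A i\<close> is the homogeneous part of degree \<open>i\<close>; the underlying algebra is the whole type.\<close>

locale cdga =
  fixes A :: "nat \<Rightarrow> 'a::complex_algebra_1 set" and d :: "'a \<Rightarrow> 'a"
  assumes subspace: "csubspace (A i)"
    and direct_sum: "\<exists>!f. (\<forall>i. f i \<in> A i) \<and> finite {i. f i \<noteq> 0} \<and> x = (\<Sum>i | f i \<noteq> 0. f i)"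
    and one_degree: "1 \<in> A 0"
    and mult_degree: "a \<in> A i \<Longrightarrow> b \<in> A j \<Longrightarrow> a * b \<in> A (i + j)"
    and graded_commute: "a \<in> A i \<Longrightarrow> b \<in> A j \<Longrightarrow> a * b = (- 1) ^ (i * j) * (b * a)"
    and diff_linear: "clinear d"
    and diff_degree: "a \<in> A i \<Longrightarrow> d a \<in> A (Suc i)"
    and diff_diff: "d (d a) = 0"
    and leibniz: "a \<in> A i \<Longrightarrow> d (a * b) = d a * b + (- 1) ^ i * (a * d b)"

locale connected_cdga = cdga +
  assumes connected: "A 0 = {c *\<^sub>C 1 | c. True}"

locale one_finite_cdga = connected_cdga +
  assumes one_finite: "finite_dim (A 1)"


section \<open>Lie algebras and representations\<close>

locale lie_algebra =
  fixes br :: "'g::complex_vector \<Rightarrow> 'g \<Rightarrow> 'g"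
  assumes bilinear: "cbilinear br"
    and alternating: "br x x = 0"
    and jacobi: "br x (br y z) + br y (br z x) + br z (br x y) = 0"

locale lie_representation = lie_algebra br
  for br :: "'g::complex_vector \<Rightarrow> 'g \<Rightarrow> 'g" +
  fixes \<theta> :: "'g \<Rightarrow> 'v::complex_vector \<Rightarrow> 'v"
  assumes rep_bilinear: "cbilinear \<theta>"
    and rep_bracket: "\<theta> (br x y) v = \<theta> x (\<theta> y v) - \<theta> y (\<theta> x v)"


section \<open>Cohomology of cochain complexes\<close>

text \<open>A cochain complex is given by its homogeneous parts \<open>C i\<close> and its differential \<open>D\<close>.
  The cohomology \<open>cocycles C D i / coboundaries C D i\<close> is the set of cosets, with zero
  \<open>coboundaries C D i\<close>.\<close>

definition cocycles :: "(nat \<Rightarrow> 't::complex_vector set) \<Rightarrow> ('t \<Rightarrow> 't) \<Rightarrow> nat \<Rightarrow> 't set"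
  where "cocycles C D i = {x \<in> C i. D x = 0}"

definition coboundaries :: "(nat \<Rightarrow> 't::complex_vector set) \<Rightarrow> ('t \<Rightarrow> 't) \<Rightarrow> nat \<Rightarrow> 't set"
  where "coboundaries C D i = (case i of 0 \<Rightarrow> {0} | Suc j \<Rightarrow> D ` C j)"

definition quotient_space :: "'t::complex_vector set \<Rightarrow> 't set \<Rightarrow> 't set set"
  where "quotient_space Z B = Z // {(x, y). x \<in> Z \<and> y \<in> Z \<and> x - y \<in> B}"

definition cohomology :: "(nat \<Rightarrow> 't::complex_vector set) \<Rightarrow> ('t \<Rightarrow> 't) \<Rightarrow> nat \<Rightarrow> 't set set"
  where "cohomology C D i = quotient_space (cocycles C D i) (coboundaries C D i)"

text \<open>The dimension of \<open>Z / B\<close>, possibly infinite: the supremum of the cardinalities of the finite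
  subsets of \<open>Z\<close> whose elements have linearly independent classes modulo \<open>B\<close>.\<close>

definition independent_mod :: "'t::complex_vector set \<Rightarrow> 't set \<Rightarrow> bool"
  where "independent_mod B S \<longleftrightarrow> (\<forall>c. (\<Sum>s\<in>S. c s *\<^sub>C s) \<in> B \<longrightarrow> (\<forall>s\<in>S. c s = 0))"

definition quotient_dim :: "'t::complex_vector set \<Rightarrow> 't set \<Rightarrow> enat"
  where "quotient_dim Z B = (SUP S\<in>{S. finite S \<and> S \<subseteq> Z \<and> independent_mod B S}. enat (card S))"

definition cohomology_dim :: "(nat \<Rightarrow> 't::complex_vector set) \<Rightarrow> ('t \<Rightarrow> 't) \<Rightarrow> nat \<Rightarrow> enat"
  where "cohomology_dim C D i = quotient_dim (cocycles C D i) (coboundaries C D i)"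


section \<open>Flat connections and resonance varieties\<close>

definition tensor_degree ::
    "(nat \<Rightarrow> 'a::complex_vector set) \<Rightarrow> nat \<Rightarrow> ('a, 'v::complex_vector) tensor set"
  where "tensor_degree A i = cspan {a \<otimes>\<^sub>C v | a v. a \<in> A i}"

definition tensor_bracket ::
    "('g::complex_vector \<Rightarrow> 'g \<Rightarrow> 'g) \<Rightarrow>
     ('a::complex_algebra_1, 'g) tensor \<Rightarrow> ('a, 'g) tensor \<Rightarrow> ('a, 'g) tensor"
  where "tensor_bracket br \<omega> \<psi> =
    tensor_lift (\<lambda>\<alpha> x. tensor_lift (\<lambda>\<beta> y. (\<alpha> * \<beta>) \<otimes>\<^sub>C br x y) \<psi>) \<omega>"

definition tensor_diff ::
    "('a::complex_vector \<Rightarrow> 'a) \<Rightarrow> ('a, 'g::complex_vector) tensor \<Rightarrow> ('a, 'g) tensor"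
  where "tensor_diff d = tensor_lift (\<lambda>\<alpha> x. d \<alpha> \<otimes>\<^sub>C x)"

definition flat_connections ::
    "(nat \<Rightarrow> 'a::complex_algebra_1 set) \<Rightarrow> ('a \<Rightarrow> 'a) \<Rightarrow>
     ('g::complex_vector \<Rightarrow> 'g \<Rightarrow> 'g) \<Rightarrow> ('a, 'g) tensor set"
  where "flat_connections A d br =
    {\<omega> \<in> tensor_degree A 1. tensor_diff d \<omega> + (1 / 2) *\<^sub>C tensor_bracket br \<omega> \<omega> = 0}"

text \<open>The inner \<open>tensor_lift\<close> is the sum of the \<open>\<eta>\<^sub>i \<alpha> \<otimes> \<theta>(g\<^sub>i) v\<close> for \<open>\<omega>\<close> the sum of the
  \<open>\<eta>\<^sub>i \<otimes> g\<^sub>i\<close>.\<close>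

definition cov_diff ::
    "('a::complex_algebra_1 \<Rightarrow> 'a) \<Rightarrow> ('g::complex_vector \<Rightarrow> 'v::complex_vector \<Rightarrow> 'v) \<Rightarrow>
     ('a, 'g) tensor \<Rightarrow> ('a, 'v) tensor \<Rightarrow> ('a, 'v) tensor"
  where "cov_diff d \<theta> \<omega> =
    tensor_lift (\<lambda>\<alpha> v. d \<alpha> \<otimes>\<^sub>C v + tensor_lift (\<lambda>\<eta> g. (\<eta> * \<alpha>) \<otimes>\<^sub>C \<theta> g v) \<omega>)"

definition resonance ::
    "(nat \<Rightarrow> 'a::complex_algebra_1 set) \<Rightarrow> ('a \<Rightarrow> 'a) \<Rightarrow>
     ('g::complex_vector \<Rightarrow> 'g \<Rightarrow> 'g) \<Rightarrow> ('g \<Rightarrow> 'v::complex_vector \<Rightarrow> 'v) \<Rightarrow>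
     nat \<Rightarrow> nat \<Rightarrow> ('a, 'g) tensor set"
  where "resonance A d br \<theta> i r =
    {\<omega> \<in> flat_connections A d br. cohomology_dim (tensor_degree A) (cov_diff d \<theta> \<omega>) i \<ge> enat r}"

text \<open>Rank one: the abelian Lie algebra \<open>\<complex>\<close> with \<open>\<theta> = id\<close>, where \<open>c \<in> gl(\<complex>) = \<complex>\<close> acts by
  multiplication, and \<open>\<alpha> \<in> A 1\<close> is identified with \<open>\<alpha> \<otimes> 1\<close>.\<close>

definition resonance_rank_one ::
    "(nat \<Rightarrow> 'a::complex_algebra_1 set) \<Rightarrow> ('a \<Rightarrow> 'a) \<Rightarrow> nat \<Rightarrow> nat \<Rightarrow> 'a set"
  where "resonance_rank_one A d i r =
    {\<alpha> \<in> A 1. \<alpha> \<otimes>\<^sub>C (1 :: complex) \<in>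
      resonance A d (\<lambda>_ _. 0) ((*) :: complex \<Rightarrow> complex \<Rightarrow> complex) i r}"

definition pi_locus ::
    "(nat \<Rightarrow> 'a::complex_algebra_1 set) \<Rightarrow> ('a \<Rightarrow> 'a) \<Rightarrow>
     ('g::complex_vector \<Rightarrow> 'v::complex_vector \<Rightarrow> 'v) \<Rightarrow> ('a, 'g) tensor set"
  where "pi_locus A d \<theta> = {\<eta> \<otimes>\<^sub>C g | \<eta> g. \<eta> \<in> A 1 \<and> d \<eta> = 0 \<and> endo_det (\<theta> g) = 0}"

lemma lie_algebra_complex: "lie_algebra (\<lambda>_ _ :: complex. 0 :: complex)"
  by standard (auto intro: cbilinearI)

lemma lie_representation_complex: "lie_representation (\<lambda>_ _. 0) ((*) :: complex \<Rightarrow> complex \<Rightarrow> complex)"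
  by (intro lie_representation.intro lie_algebra_complex lie_representation_axioms.intro cbilinearI)
     (auto simp: algebra_simps scaleC_complex_def)

lemma tensor_diff_pure:
  assumes "clinear d"
  shows "tensor_diff d (\<alpha> \<otimes>\<^sub>C x) = d \<alpha> \<otimes>\<^sub>C x"
  unfolding tensor_diff_def
  by (intro tensor_lift_pure cbilinearI)
     (simp_all only: clinearD(1,2)[OF assms] cbilinearD[OF cbilinear_pure_tensor])

lemma cbilinear_mult_tensor:
  fixes \<alpha> \<beta> :: "'a::complex_algebra_1"
  assumes "cbilinear h"
  shows "cbilinear (\<lambda>\<beta> y. (\<alpha> * \<beta>) \<otimes>\<^sub>C h x y)"
    and "cbilinear (\<lambda>\<alpha> x. (\<alpha> * \<beta>) \<otimes>\<^sub>C h x y)"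
  by (auto intro!: cbilinearI simp: distrib_left distrib_right mult_scaleC_left mult_scaleC_right
      cbilinearD[OF assms] cbilinearD[OF cbilinear_pure_tensor])

lemma tensor_bracket_pure:
  assumes "cbilinear br"
  shows "tensor_bracket br (\<alpha> \<otimes>\<^sub>C x) (\<beta> \<otimes>\<^sub>C y) = (\<alpha> * \<beta>) \<otimes>\<^sub>C br x y"
proof -
  note mult = cbilinear_mult_tensor[OF assms]
  have "cbilinear (\<lambda>\<alpha> x. tensor_lift (\<lambda>\<beta> y. (\<alpha> * \<beta>) \<otimes>\<^sub>C br x y) (\<beta> \<otimes>\<^sub>C y))"
    by (simp only: tensor_lift_pure[OF mult(1)] mult(2))
  then show ?thesis
    by (simp add: tensor_bracket_def tensor_lift_pure mult)
qed

lemma cov_diff_pure: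
  fixes \<alpha> :: "'a::complex_algebra_1"
  assumes "clinear d" "cbilinear \<theta>"
  shows "cov_diff d \<theta> (\<Sum>i\<in>I. \<eta> i \<otimes>\<^sub>C g i) (\<alpha> \<otimes>\<^sub>C v) =
    d \<alpha> \<otimes>\<^sub>C v + (\<Sum>i\<in>I. (\<eta> i * \<alpha>) \<otimes>\<^sub>C \<theta> (g i) v)"
proof -
  have bil: "cbilinear (\<lambda>\<eta> g. (\<eta> * \<alpha>) \<otimes>\<^sub>C \<theta> g v)" for \<alpha> :: 'a and v
    by (rule cbilinear_mult_tensor(2)[OF assms(2)])
  have inner: "tensor_lift (\<lambda>\<eta> g. (\<eta> * \<alpha>) \<otimes>\<^sub>C \<theta> g v) (\<Sum>i\<in>I. \<eta> i \<otimes>\<^sub>C g i) =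
      (\<Sum>i\<in>I. (\<eta> i * \<alpha>) \<otimes>\<^sub>C \<theta> (g i) v)" for \<alpha> :: 'a and v
    by (simp add: clinear_sum[OF clinear_tensor_lift[OF bil]] tensor_lift_pure[OF bil])
  have "cbilinear (\<lambda>\<alpha> v. d \<alpha> \<otimes>\<^sub>C v + (\<Sum>i\<in>I. (\<eta> i * \<alpha>) \<otimes>\<^sub>C \<theta> (g i) v))"
    by (rule cbilinearI)
       (simp_all add: distrib_left mult_scaleC_right clinearD(1,2)[OF assms(1)] sum.distrib
          cbilinearD[OF assms(2)] cbilinearD[OF cbilinear_pure_tensor] scaleC_add_right
          complex_vector.scale_sum_right)
  then show ?thesis
    by (simp add: cov_diff_def inner tensor_lift_pure)
qed

end

theory Submission
  imports Defs "HOL-Computational_Algebra.Fundamental_Theorem_Algebra"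
begin

text \<open>For \<open>\<omega> = \<eta> \<otimes> g\<close> and \<open>T = \<theta> g\<close> the complex \<open>(A \<otimes> V, d\<^sub>\<omega>)\<close> has differential
  \<open>d \<otimes> id + \<eta> \<otimes> T\<close>, and the matter is to compare its exactness in degree \<open>k\<close> with that of the
  complexes \<open>(A, d + c \<eta>)\<close> for the eigenvalues \<open>c\<close> of \<open>T\<close> (\<open>exact_tensor_iff\<close>). All cohomological
  arguments take place in the single degree \<open>k\<close>.

  If all the complexes \<open>(A, d + c \<eta>)\<close> are exact at \<open>k\<close>, then so is \<open>A \<otimes> V\<close>: triangularize \<open>T\<close>; the
  resulting filtration of \<open>A \<otimes> V\<close> has subquotients \<open>(A, d + c \<eta>)\<close> (\<open>exact_tensor_of_exact_scalar\<close>,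
  by the induction rule \<open>triangular_induct\<close>).

  The converse does not follow from the filtration alone, because the connecting maps between the
  subquotients may cancel cohomology. These maps are, however, built from multiplication by \<open>\<eta>\<close>. For a Jordan
  block of size two, exactness of \<open>A \<otimes> V\<close> at \<open>k\<close> says that multiplication by \<open>\<eta>\<close> is surjective
  from degree \<open>k - 1\<close> to degree \<open>k\<close> of the cohomology of \<open>(A, d + c \<eta>)\<close> and injective from degree
  \<open>k\<close> to degree \<open>k + 1\<close>; as \<open>\<eta> \<eta> = 0\<close>, the cohomology in degree \<open>k\<close> vanishes. The same mechanism
  works for every \<open>T\<close>, with an eigenvector of \<open>T\<close> and an eigenvector of its transpose in place of the
  Jordan form (\<open>exact_scalar_of_exact_tensor\<close>).

  Finally, \<open>det (\<theta> g) = 0\<close> means that \<open>0\<close> is an eigenvalue of \<open>\<theta> g\<close>, and the complex attached to it is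
  \<open>(A, d)\<close> itself.\<close>

section \<open>Endomorphisms of finite-dimensional complex vector spaces\<close>

lemma separating_functional:
  fixes W :: "'v::complex_vector set"
  assumes "csubspace W" "w \<notin> W"
  obtains \<phi> :: "'v \<Rightarrow> complex"
  where "clinear \<phi>" "\<And>x. x \<in> W \<Longrightarrow> \<phi> x = 0" "\<phi> w = 1"
proof -
  interpret P: vector_space_pair "scaleC :: complex \<Rightarrow> 'v \<Rightarrow> 'v" "scaleC :: complex \<Rightarrow> complex \<Rightarrow> complex" ..
  obtain B where B: "B \<subseteq> W" "\<not> cdependent B" "W \<subseteq> cspan B"
    by (rule complex_vector.maximal_independent_subset)
  have span: "cspan B = W"
    using B(1,3) assms(1) by (metis complex_vector.span_minimal subset_antisym)
  have "\<not> cdependent (insert w B)"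
    using B(2) assms(2) span by (simp add: complex_vector.independent_insertI)
  from P.linear_independent_extend[OF this[unfolded cdependent_def], of "\<lambda>x. if x = w then 1 else 0"]
  obtain \<phi> :: "'v \<Rightarrow> complex" where \<phi>: "clinear \<phi>" "\<forall>x\<in>insert w B. \<phi> x = (if x = w then 1 else 0)"
    by blast
  have "\<phi> x = 0" if "x \<in> W" for x
    using that[folded span]
  proof (induction rule: complex_vector.span_induct_alt)
    case base
    show ?case by (rule clinearD(3)[OF \<phi>(1)])
  next
    case (step c x y)
    have "x \<noteq> w" using step(1) B(1) assms(2) by blast
    with step \<phi> show ?case by (simp add: clinearD(1,2))
  qed
  with \<phi> show thesis by (intro that[of \<phi>]) auto
qed

text \<open>An element of \<open>W\<close> outside \<open>f ` W\<close> would enlarge the image of a basis of \<open>W\<close> to an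
  independent subset of \<open>W\<close> with more elements than the basis.\<close>

lemma injective_endo_of_finite_dim_subspace_surj:
  fixes f :: "'v::complex_vector \<Rightarrow> 'v"
  assumes "finite_dim (UNIV :: 'v set)" "clinear f" "csubspace W" "f ` W \<subseteq> W"
    and inj: "\<And>x. f x = 0 \<Longrightarrow> x = 0"
  shows "f ` W = W"
proof -
  interpret f: Vector_Spaces.linear scaleC scaleC f by fact
  obtain F where F: "finite F" "cspan F = (UNIV :: 'v set)"
    using assms(1) unfolding finite_dim_def by blast
  obtain B where B: "B \<subseteq> W" "\<not> cdependent B" "W \<subseteq> cspan B"
    by (rule complex_vector.maximal_independent_subset)
  have fin: "finite B"
    using complex_vector.independent_span_bound[OF F(1) B(2)] F(2) by simp
  have span: "cspan B = W"
    using B(1,3) assms(3) by (metis complex_vector.span_minimal subset_antisym)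
  have f_inj: "inj f"
    by (rule injI) (metis inj clinearD(4)[OF assms(2)] right_minus_eq)
  have ind: "\<not> cdependent (f ` B)"
    using f.independent_injective_image[OF B(2)[unfolded cdependent_def]] f_inj
    unfolding cdependent_def by (meson inj_on_subset subset_UNIV)
  have "x \<in> cspan (f ` B)" if "x \<in> W" for x
  proof (rule ccontr)
    assume x: "x \<notin> cspan (f ` B)"
    have "\<not> cdependent (insert x (f ` B))"
      using x ind by (simp add: complex_vector.independent_insertI)
    moreover have "insert x (f ` B) \<subseteq> cspan B"
      using that B(1) assms(4) span by auto
    ultimately have "card (insert x (f ` B)) \<le> card B"
      using complex_vector.independent_span_bound[OF fin] by blast
    moreover have "card (f ` B) = card B"
      using f_inj by (meson card_image inj_on_subset subset_UNIV)
    moreover have "x \<notin> f ` B"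
      using x complex_vector.span_base by blast
    ultimately show False using fin by simp
  qed
  moreover have "cspan (f ` B) = f ` W"
    using f.span_image[of B] span unfolding cspan_def by simp
  ultimately show ?thesis using assms(4) by blast
qed

lemma clinear_diff_scale:
  assumes "clinear f" shows "clinear (\<lambda>v. f v - c *\<^sub>C v)"
  by (rule clinearI) (simp_all add: clinearD[OF assms] scaleC_add_right scaleC_scaleC
       complex_vector.scale_right_diff_distrib mult.commute)

text \<open>An eigenvalue of \<open>f\<close> is also an eigenvalue of the transpose of \<open>f\<close>: in finite dimension
  \<open>f - c\<close> cannot be surjective without being injective, so some \<open>w\<close> lies outside its range, and
  \<open>\<phi>\<close> is a functional that separates \<open>w\<close> from the range.\<close>

lemma singular_endo_left_eigenfunctional:
  fixes f :: "'v::complex_vector \<Rightarrow> 'v"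
  assumes "finite_dim (UNIV :: 'v set)" "clinear f" "endo_eigenvalue f c"
  obtains \<phi> :: "'v \<Rightarrow> complex" and w
  where "clinear \<phi>" "\<And>v. \<phi> (f v - c *\<^sub>C v) = 0" "\<phi> w = 1"
proof -
  interpret P: vector_space_pair "scaleC :: complex \<Rightarrow> 'v \<Rightarrow> 'v" "scaleC :: complex \<Rightarrow> 'v \<Rightarrow> 'v" ..
  let ?N = "\<lambda>v. f v - c *\<^sub>C v"
  have N: "clinear ?N" by (rule clinear_diff_scale[OF assms(2)])
  interpret N: Vector_Spaces.linear scaleC scaleC ?N by (rule N)
  have "range ?N \<noteq> UNIV"
  proof
    assume "range ?N = UNIV"
    then obtain g where g: "clinear g" "?N \<circ> g = id"
      using P.linear_surjective_right_inverse[OF N] by blast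
    have "g ` UNIV = UNIV"
    proof (rule injective_endo_of_finite_dim_subspace_surj[OF assms(1) g(1)])
      fix x assume "g x = 0"
      then show "x = 0" using fun_cong[OF g(2), of x] by (simp add: clinearD(3)[OF assms(2)])
    qed (simp_all add: complex_vector.subspace_UNIV)
    moreover obtain v where v: "v \<noteq> 0" "f v = c *\<^sub>C v"
      using assms(3) by (auto simp: endo_eigenvalue_def)
    ultimately obtain u where u: "v = g u" by blast
    have "u = ?N (g u)" using fun_cong[OF g(2), of u] by simp
    also have "\<dots> = 0" using v(2) by (simp add: u)
    finally show False using v(1) u by (simp add: clinearD(3)[OF g(1)])
  qed
  then obtain w where "w \<notin> range ?N" by blast
  moreover have "csubspace (range ?N)"
    using N.subspace_image[of UNIV] by (simp add: csubspace_def complex_vector.subspace_UNIV[unfolded csubspace_def])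
  ultimately obtain \<phi> :: "'v \<Rightarrow> complex"
    where "clinear \<phi>" "\<And>x. x \<in> range ?N \<Longrightarrow> \<phi> x = 0" "\<phi> w = 1"
    using separating_functional by blast
  then show thesis by (intro that[of \<phi> w]) auto
qed

definition poly_endo :: "complex poly \<Rightarrow> ('v::complex_vector \<Rightarrow> 'v) \<Rightarrow> 'v \<Rightarrow> 'v"
  where "poly_endo p f u = (\<Sum>i\<le>degree p. coeff p i *\<^sub>C (f ^^ i) u)"

lemma poly_endo_bound:
  assumes "degree p \<le> n"
  shows "poly_endo p f u = (\<Sum>i\<le>n. coeff p i *\<^sub>C (f ^^ i) u)"
  unfolding poly_endo_def
  by (rule sum.mono_neutral_left) (use assms in \<open>auto simp: coeff_eq_0\<close>)

lemma poly_endo_linear_factor: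
  assumes "clinear f"
  shows "poly_endo ([:- a, 1:] * q) f u = f (poly_endo q f u) - a *\<^sub>C poly_endo q f u"
proof -
  let ?n = "degree q"
  have "degree ([:- a, 1:] * q) \<le> Suc ?n"
    using degree_mult_le[of "[:- a, 1:]" q] by simp
  then have "poly_endo ([:- a, 1:] * q) f u =
      (\<Sum>i\<le>Suc ?n. coeff ([:- a, 1:] * q) i *\<^sub>C (f ^^ i) u)"
    by (rule poly_endo_bound)
  also have "\<dots> = (\<Sum>i\<le>Suc ?n. coeff (pCons 0 q) i *\<^sub>C (f ^^ i) u) - (\<Sum>i\<le>Suc ?n. (a * coeff q i) *\<^sub>C (f ^^ i) u)"
    by (simp add: sum_subtractf[symmetric] complex_vector.scale_left_diff_distrib[symmetric] del: sum.atMost_Suc)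
  also have "(\<Sum>i\<le>Suc ?n. coeff (pCons 0 q) i *\<^sub>C (f ^^ i) u) = f (poly_endo q f u)"
    by (subst sum.atMost_Suc_shift) (simp add: poly_endo_def clinear_sum[OF assms] clinearD[OF assms])
  also have "(\<Sum>i\<le>Suc ?n. (a * coeff q i) *\<^sub>C (f ^^ i) u) = a *\<^sub>C poly_endo q f u"
    by (simp add: poly_endo_bound[of q "Suc ?n"] complex_vector.scale_sum_right scaleC_scaleC del: sum.atMost_Suc)
  finally show ?thesis .
qed

lemma annihilating_polynomial:
  fixes f :: "'v::complex_vector \<Rightarrow> 'v"
  assumes "finite_dim (UNIV :: 'v set)"
  obtains p where "p \<noteq> 0" "poly_endo p f u = 0"
proof -
  obtain F where F: "finite F" "cspan F = (UNIV :: 'v set)"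
    using assms unfolding finite_dim_def by blast
  let ?n = "card F" and ?v = "\<lambda>i. (f ^^ i) u"
  obtain c where c: "(\<Sum>i\<le>?n. c i *\<^sub>C ?v i) = 0" "\<exists>i\<le>?n. c i \<noteq> 0"
  proof (cases "inj_on ?v {..?n}")
    case True
    have "cdependent (?v ` {..?n})"
    proof (rule ccontr)
      assume "\<not> ?thesis"
      from complex_vector.independent_span_bound[OF F(1) this] F(2) True
      show False by (simp add: card_image)
    qed
    then obtain b where b: "(\<Sum>x\<in>?v ` {..?n}. b x *\<^sub>C x) = 0" "\<exists>x\<in>?v ` {..?n}. b x \<noteq> 0"
      using complex_vector.dependent_finite[of "?v ` {..?n}"] by auto
    show thesis
      by (rule that[of "\<lambda>i. b (?v i)"]) (use b True in \<open>auto simp: sum.reindex\<close>)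
  next
    case False
    then obtain i j where ij: "i \<le> ?n" "j \<le> ?n" "i \<noteq> j" "?v i = ?v j"
      by (auto simp: inj_on_def)
    \<comment> \<open>The coefficients of \<open>X ^ i - X ^ j\<close>.\<close>
    let ?c = "\<lambda>k. (if k = i then 1 else 0) - (if k = j then 1 else 0 :: complex)"
    have "(\<Sum>k\<le>?n. ?c k *\<^sub>C ?v k) = (\<Sum>k\<le>?n. if k = i then ?v k else 0) - (\<Sum>k\<le>?n. if k = j then ?v k else 0)"
      unfolding sum_subtractf[symmetric]
      by (intro sum.cong) (auto simp: complex_vector.scale_left_diff_distrib scaleC_one)
    also have "\<dots> = 0" using ij by simp
    finally show thesis
      by (rule that[of ?c]) (use ij in auto)
  qed
  let ?p = "\<Sum>i\<le>?n. monom (c i) i"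
  have coeff: "coeff ?p i = (if i \<le> ?n then c i else 0)" for i
    by (simp add: coeff_sum)
  have "degree ?p \<le> ?n"
    by (rule degree_le) (simp add: coeff)
  then have "poly_endo ?p f u = 0"
    using c(1) by (simp add: poly_endo_bound coeff)
  moreover have "?p \<noteq> 0"
    using c(2) coeff by (metis coeff_0)
  ultimately show thesis by (rule that[rotated])
qed

text \<open>By the fundamental theorem of algebra \<open>p\<close> is, up to a constant, a product of factors
  \<open>X - a\<close>. Applying the corresponding operators to \<open>u\<close> one after another leads from outside \<open>W\<close>
  into \<open>W\<close>; the vector \<open>w\<close> is the last one outside. The quotient by \<open>W\<close>, in which \<open>w\<close> becomes an
  eigenvector, is never formed.\<close>

lemma eigenvector_modulo_subspace_of_polynomial:
  fixes f :: "'v::complex_vector \<Rightarrow> 'v"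
  assumes "clinear f" "csubspace W" "u \<notin> W" "p \<noteq> 0" "poly_endo p f u \<in> W"
  shows "\<exists>w a. w \<notin> W \<and> f w - a *\<^sub>C w \<in> W"
  using assms(4,5)
proof (induction "degree p" arbitrary: p rule: less_induct)
  case less
  show ?case
  proof (cases "degree p = 0")
    case True
    then obtain c where "p = [:c:]" by (rule degree_eq_zeroE)
    with less.prems have "c \<noteq> 0" "c *\<^sub>C u \<in> W" by (auto simp: poly_endo_def)
    then have "inverse c *\<^sub>C c *\<^sub>C u \<in> W"
      using assms(2) complex_vector.subspace_scale by blast
    then show ?thesis using \<open>c \<noteq> 0\<close> assms(3) by (simp add: scaleC_scaleC scaleC_one)
  next
    case False
    then obtain a where "poly p a = 0"
      using fundamental_theorem_of_algebra[of p] by (auto simp: constant_degree)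
    then obtain q where q: "p = [:- a, 1:] * q" by (auto simp: poly_eq_0_iff_dvd)
    show ?thesis
    proof (cases "poly_endo q f u \<in> W")
      case True
      have "q \<noteq> 0" using q less.prems(1) by auto
      then have "degree q < degree p" unfolding q by (subst degree_mult_eq) auto
      with less.hyps True \<open>q \<noteq> 0\<close> show ?thesis by blast
    next
      case False
      then show ?thesis
        using less.prems(2) unfolding q poly_endo_linear_factor[OF assms(1)] by blast
    qed
  qed
qed

text \<open>Triangularizability over the complex numbers, as an induction rule: the whole space is reached
  along a flag of invariant subspaces, each obtained from the previous one by adjoining a vector
  that is an eigenvector modulo it. The diagonal entry \<open>a\<close> is an eigenvalue of \<open>f\<close> itself: otherwise
  \<open>f - a\<close> would map \<open>W\<close> onto \<open>W\<close>, and \<open>f w - a w\<close>, being in \<open>W\<close>, would have a second preimage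
  in \<open>W\<close>.\<close>

lemma triangular_induct [consumes 2, case_names zero step]:
  fixes f :: "'v::complex_vector \<Rightarrow> 'v"
  assumes fd: "finite_dim (UNIV :: 'v set)" and lin: "clinear f"
    and zero: "P {0}"
    and step: "\<And>W w a. csubspace W \<Longrightarrow> f ` W \<subseteq> W \<Longrightarrow> w \<notin> W \<Longrightarrow> f w - a *\<^sub>C w \<in> W \<Longrightarrow>
      endo_eigenvalue f a \<Longrightarrow> P W \<Longrightarrow> P (cspan (insert w W))"
  shows "P UNIV"
proof (rule ccontr)
  assume not: "\<not> P UNIV"
  \<comment> \<open>If the flag never reaches the whole space, it produces independent sets of every size.\<close>
  have "\<exists>B. finite B \<and> card B = n \<and> \<not> cdependent B \<and> f ` cspan B \<subseteq> cspan B \<and> P (cspan B)" for n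
  proof (induction n)
    case 0
    show ?case
      using zero by (intro exI[of _ "{}"]) (simp add: complex_vector.independent_empty clinearD(3)[OF lin])
  next
    case (Suc n)
    then obtain B where B: "finite B" "card B = n" "\<not> cdependent B" "f ` cspan B \<subseteq> cspan B" "P (cspan B)"
      by blast
    let ?W = "cspan B"
    have sub: "csubspace ?W" by (rule complex_vector.subspace_span)
    from B(5) not obtain u where "u \<notin> ?W" by (metis UNIV_eq_I)
    moreover obtain p where "p \<noteq> 0" "poly_endo p f u = 0"
      by (rule annihilating_polynomial[OF fd])
    ultimately obtain w a where w: "w \<notin> ?W" "f w - a *\<^sub>C w \<in> ?W"
      using eigenvector_modulo_subspace_of_polynomial[OF lin sub] complex_vector.span_zero by metis
    let ?N = "\<lambda>v. f v - a *\<^sub>C v"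
    have N: "clinear ?N" by (rule clinear_diff_scale[OF lin])
    have NW: "?N ` ?W \<subseteq> ?W"
      using B(4) by (auto intro!: complex_vector.span_diff complex_vector.span_scale)
    have ev: "endo_eigenvalue f a"
    proof (rule ccontr)
      assume "\<not> ?thesis"
      then have inj: "?N x = 0 \<Longrightarrow> x = 0" for x by (auto simp: endo_eigenvalue_def)
      have "?N ` ?W = ?W"
        by (rule injective_endo_of_finite_dim_subspace_surj[OF fd N sub NW inj])
      with w(2) have "?N w \<in> ?N ` ?W" by simp
      then obtain x where x: "x \<in> ?W" "?N w = ?N x" by (rule imageE)
      then have "?N (w - x) = 0" by (simp only: clinearD(4)[OF N] diff_self)
      from inj[OF this] x(1) w(1) show False by simp
    qed
    have span: "cspan (insert w ?W) = cspan (insert w B)"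
      using complex_vector.span_insert[of w ?W] complex_vector.span_insert[of w B] by (simp add: complex_vector.span_span)
    have inv: "f x \<in> cspan (insert w B)" if "x \<in> cspan (insert w B)" for x
      using that
    proof (induction rule: complex_vector.span_induct_alt)
      case base
      show ?case by (simp add: clinearD(3)[OF lin] complex_vector.span_zero)
    next
      case (step c x y)
      have mono: "?W \<subseteq> cspan (insert w B)" by (rule complex_vector.span_mono) blast
      have "f x \<in> cspan (insert w B)"
      proof (cases "x = w")
        case True
        have "?N w \<in> cspan (insert w B)" using w(2) mono by blast
        moreover have "a *\<^sub>C w \<in> cspan (insert w B)"
          by (intro complex_vector.span_scale complex_vector.span_base) simp
        ultimately have "?N w + a *\<^sub>C w \<in> cspan (insert w B)"
          by (rule complex_vector.span_add)
        then show ?thesis by (simp add: True)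
      next
        case False
        then have "x \<in> ?W" using step(1) complex_vector.span_base by blast
        then show ?thesis using B(4) mono by blast
      qed
      with step(2) show ?case
        by (simp add: clinearD[OF lin] complex_vector.span_add complex_vector.span_scale)
    qed
    have "w \<notin> B" using w(1) complex_vector.span_base by blast
    then show ?case
      using B(1-3) w(1) inv step[OF sub B(4) w ev B(5)]
      by (intro exI[of _ "insert w B"]) (auto simp: span complex_vector.independent_insertI)
  qed
  moreover obtain F where F: "finite F" "cspan F = (UNIV :: 'v set)"
    using fd unfolding finite_dim_def by blast
  ultimately obtain B :: "'v set" where "card B = Suc (card F)" "\<not> cdependent B" by blast
  with complex_vector.independent_span_bound[OF F(1), of B] F(2) show False by simp
qed

lemma ordered_basis_exists:
  assumes "finite_dim (UNIV :: 'v::complex_vector set)"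
  shows "\<exists>bs :: 'v list. ordered_basis bs"
proof -
  obtain F where F: "finite F" "cspan F = (UNIV :: 'v set)"
    using assms unfolding finite_dim_def by blast
  obtain B where B: "B \<subseteq> F" "\<not> cdependent B" "F \<subseteq> cspan B"
    by (rule complex_vector.maximal_independent_subset)
  have "cspan B = UNIV"
    using B(3) F(2) complex_vector.span_mono[OF B(3)] by (auto simp: complex_vector.span_span)
  moreover obtain bs where "set bs = B" "distinct bs"
    using finite_distinct_list finite_subset[OF B(1) F(1)] by blast
  ultimately show ?thesis using B(2) by (auto simp: ordered_basis_def)
qed

text \<open>A vector killed by the matrix of \<open>f\<close> is the coordinate vector of a vector killed by \<open>f\<close>.\<close>

lemma endo_det_zero_imp_eigenvalue_zero:
  fixes f :: "'v::complex_vector \<Rightarrow> 'v"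
  assumes "finite_dim (UNIV :: 'v set)" "clinear f" "endo_det f = 0"
  shows "endo_eigenvalue f 0"
proof -
  define bs where "bs = (SOME bs :: 'v list. ordered_basis bs)"
  have bs: "distinct bs" "\<not> cdependent (set bs)" "cspan (set bs) = UNIV"
    using someI_ex[OF ordered_basis_exists[OF assms(1)]] unfolding bs_def ordered_basis_def by auto
  let ?n = "length bs" and ?M = "endo_matrix bs f"
  have M: "?M \<in> carrier_mat ?n ?n" by (simp add: endo_matrix_def)
  have "det ?M = 0" using assms(3) by (simp add: endo_det_def bs_def)
  then obtain v where v: "v \<in> carrier_vec ?n" "v \<noteq> 0\<^sub>v ?n" "?M *\<^sub>v v = 0\<^sub>v ?n"
    using det_0_iff_vec_prod_zero_field[OF M] by blast
  have nth_sum: "(\<Sum>b\<in>set bs. h b) = (\<Sum>i<?n. h (bs ! i))" for h :: "'v \<Rightarrow> 'v"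
    using bs(1) by (simp add: sum.distinct_set_conv_list sum_list_sum_nth atLeast0LessThan)
  let ?x = "\<Sum>j<?n. (v $ j) *\<^sub>C (bs ! j)"
  have rep: "(\<Sum>i<?n. crepresentation (set bs) y (bs ! i) *\<^sub>C (bs ! i)) = y" for y
    using complex_vector.sum_representation_eq[OF bs(2), of y "set bs"] bs(3)
    by (simp add: nth_sum)
  have "f ?x = (\<Sum>j<?n. (v $ j) *\<^sub>C f (bs ! j))"
    by (simp add: clinear_sum[OF assms(2)] clinearD[OF assms(2)])
  also have "\<dots> = (\<Sum>j<?n. \<Sum>i<?n. (?M $$ (i, j) * v $ j) *\<^sub>C (bs ! i))"
    by (rule sum.cong[OF refl], subst (1) rep[symmetric])
       (simp add: endo_matrix_def complex_vector.scale_sum_right scaleC_scaleC mult.commute)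
  also have "\<dots> = (\<Sum>i<?n. (?M *\<^sub>v v) $ i *\<^sub>C (bs ! i))"
    by (subst sum.swap) (use M v(1) in \<open>auto intro!: sum.cong simp: scalar_prod_def
         complex_vector.scale_sum_left[symmetric] atLeast0LessThan\<close>)
  also have "\<dots> = 0" by (simp add: v(3))
  finally have "f ?x = 0" .
  moreover have "?x \<noteq> 0"
  proof
    assume "?x = 0"
    \<comment> \<open>The coordinates, reindexed by the basis vectors instead of their positions.\<close>
    define h where "h b = v $ (THE j. j < ?n \<and> bs ! j = b)" for b
    have h: "h (bs ! j) = v $ j" if "j < ?n" for j
    proof -
      have "(THE i. i < ?n \<and> bs ! i = bs ! j) = j"
        using that bs(1) by (auto simp: nth_eq_iff_index_eq)
      then show ?thesis by (simp add: h_def)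
    qed
    have "(\<Sum>b\<in>set bs. h b *\<^sub>C b) = 0"
      using \<open>?x = 0\<close> by (simp add: nth_sum h)
    then have "h b = 0" if "b \<in> set bs" for b
      using bs(2) that complex_vector.dependent_finite[of "set bs"] by auto
    then have "v = 0\<^sub>v ?n"
      using v(1) by (intro eq_vecI) (auto simp flip: h)
    with v(2) show False by simp
  qed
  ultimately show ?thesis by (auto simp: endo_eigenvalue_def)
qed

section \<open>Subspaces of tensor products and contractions\<close>

text \<open>The image of \<open>S \<otimes> W\<close> in the ambient tensor product.\<close>

definition tensor_subspace :: "'a::complex_vector set \<Rightarrow> 'v::complex_vector set \<Rightarrow> ('a, 'v) tensor set"
  where "tensor_subspace S W = cspan {a \<otimes>\<^sub>C v | a v. a \<in> S \<and> v \<in> W}"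

lemma tensor_degree_eq: "tensor_degree A i = tensor_subspace (A i) UNIV"
  by (simp add: tensor_degree_def tensor_subspace_def)

lemma tensor_zero_left: "(0 :: 'a::complex_vector) \<otimes>\<^sub>C (v :: 'v::complex_vector) = 0"
  using cbilinearD(2)[OF cbilinear_pure_tensor, of 0 "0 :: 'a" v] by simp

lemma tensor_zero_right: "(a :: 'a::complex_vector) \<otimes>\<^sub>C (0 :: 'v::complex_vector) = 0"
  using cbilinearD(4)[OF cbilinear_pure_tensor, of a 0 "0 :: 'v"] by simp

lemma tensor_minus_left: "(- a :: 'a::complex_vector) \<otimes>\<^sub>C (v :: 'v::complex_vector) = - (a \<otimes>\<^sub>C v)"
  using cbilinearD(1)[OF cbilinear_pure_tensor, of "- a" a v]
  by (simp add: tensor_zero_left eq_neg_iff_add_eq_0)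

lemma pure_in_tensor_subspace: "a \<in> S \<Longrightarrow> v \<in> W \<Longrightarrow> a \<otimes>\<^sub>C v \<in> tensor_subspace S W"
  unfolding tensor_subspace_def by (rule complex_vector.span_base) blast

lemma csubspace_tensor_subspace: "csubspace (tensor_subspace S W)"
  unfolding tensor_subspace_def by (rule complex_vector.subspace_span)

lemmas tensor_subspace_add = complex_vector.subspace_add[OF csubspace_tensor_subspace]
  and tensor_subspace_diff = complex_vector.subspace_diff[OF csubspace_tensor_subspace]
  and tensor_subspace_zero = complex_vector.subspace_0[OF csubspace_tensor_subspace]

text \<open>Linear maps out of \<open>S \<otimes> W\<close> are controlled by their values on pure tensors.\<close>

lemma clinear_tensor_subspace_in:
  assumes "clinear F" "csubspace Y" "z \<in> tensor_subspace S W"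
    and "\<And>a v. a \<in> S \<Longrightarrow> v \<in> W \<Longrightarrow> F (a \<otimes>\<^sub>C v) \<in> Y"
  shows "F z \<in> Y"
  using assms(3) unfolding tensor_subspace_def
proof (induction rule: complex_vector.span_induct_alt)
  case base
  show ?case using assms(2) by (simp add: clinearD(3)[OF assms(1)] complex_vector.subspace_0)
next
  case (step c x y)
  then have "F x \<in> Y" using assms(4) by blast
  with step(2) assms(2) show ?case
    by (simp add: clinearD[OF assms(1)] complex_vector.subspace_add complex_vector.subspace_scale)
qed

lemma tensor_subspace_insert:
  fixes S :: "'a::complex_vector set" and W :: "'v::complex_vector set"
  assumes S: "csubspace S" and z: "z \<in> tensor_subspace S (cspan (insert w W))" and W: "csubspace W"
  obtains a z' where "a \<in> S" "z' \<in> tensor_subspace S W" "z = z' + a \<otimes>\<^sub>C w"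
proof -
  note bil = cbilinearD[OF cbilinear_pure_tensor]
  have "\<exists>a\<in>S. z - a \<otimes>\<^sub>C w \<in> tensor_subspace S W"
    using z unfolding tensor_subspace_def[of S "cspan _"]
  proof (induction rule: complex_vector.span_induct_alt)
    case base
    have "0 - 0 \<otimes>\<^sub>C w \<in> tensor_subspace S W"
      by (simp add: tensor_zero_left tensor_subspace_zero)
    then show ?case using complex_vector.subspace_0[OF S] by blast
  next
    case (step c x y)
    from step(1) obtain b v where x: "x = b \<otimes>\<^sub>C v" "b \<in> S" "v \<in> cspan (insert w W)" by blast
    from x(3) obtain k where "v - k *\<^sub>C w \<in> cspan W" by (auto simp: complex_vector.span_insert)
    then have k: "v - k *\<^sub>C w \<in> W" using W by (simp add: complex_vector.span_eq_iff[THEN iffD2])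
    from step(2) obtain a where a: "a \<in> S" "y - a \<otimes>\<^sub>C w \<in> tensor_subspace S W" by blast
    let ?a = "(c * k) *\<^sub>C b + a"
    have "?a \<in> S"
      using a(1) x(2) S by (simp add: complex_vector.subspace_add complex_vector.subspace_scale)
    moreover have "c *\<^sub>C x + y - ?a \<otimes>\<^sub>C w = (c *\<^sub>C b) \<otimes>\<^sub>C (v - k *\<^sub>C w) + (y - a \<otimes>\<^sub>C w)"
    proof -
      have "v = (v - k *\<^sub>C w) + k *\<^sub>C w" by simp
      then have "x = b \<otimes>\<^sub>C (v - k *\<^sub>C w) + k *\<^sub>C (b \<otimes>\<^sub>C w)"
        unfolding x(1) by (metis bil(3,4))
      then show ?thesis by (simp add: bil scaleC_add_right scaleC_scaleC)
    qed
    moreover have "(c *\<^sub>C b) \<otimes>\<^sub>C (v - k *\<^sub>C w) \<in> tensor_subspace S W"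
      using x(2) k S by (intro pure_in_tensor_subspace complex_vector.subspace_scale)
    ultimately show ?case using a(2) tensor_subspace_add by metis
  qed
  then obtain a where "a \<in> S" "z - a \<otimes>\<^sub>C w \<in> tensor_subspace S W" by blast
  then show thesis by (intro that[of a "z - a \<otimes>\<^sub>C w"]) simp_all
qed

lemma clinear_tensor_eqI:
  assumes "clinear F" "clinear G" "\<And>a v. F (a \<otimes>\<^sub>C v) = G (a \<otimes>\<^sub>C v)"
  shows "F z = G z"
proof -
  have "clinear (\<lambda>z. F z - G z)"
    by (rule clinearI) (simp_all add: clinearD[OF assms(1)] clinearD[OF assms(2)] complex_vector.scale_right_diff_distrib)
  moreover have "z \<in> tensor_subspace UNIV UNIV"
    using span_pure_tensors unfolding tensor_subspace_def by fastforce
  ultimately have "F z - G z \<in> {0}"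
    using clinear_tensor_subspace_in[OF _ complex_vector.subspace_single_0] assms(3)
    by (metis (no_types, lifting) insertI1 right_minus_eq)
  then show ?thesis by simp
qed

text \<open>The map \<open>id \<otimes> \<phi>\<close>, with the target \<open>A \<otimes> \<complex>\<close> identified with \<open>A\<close>. It takes the place of
  coordinates with respect to a basis of \<open>V\<close>.\<close>

definition contraction :: "('v::complex_vector \<Rightarrow> complex) \<Rightarrow> ('a::complex_vector, 'v) tensor \<Rightarrow> 'a"
  where "contraction \<phi> = tensor_lift (\<lambda>a v. \<phi> v *\<^sub>C a)"

lemma
  fixes \<phi> :: "'v::complex_vector \<Rightarrow> complex" and a :: "'a::complex_vector"
  assumes "clinear \<phi>"
  shows clinear_contraction: "clinear (contraction \<phi> :: ('a, 'v) tensor \<Rightarrow> 'a)"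
    and contraction_pure: "contraction \<phi> (a \<otimes>\<^sub>C v) = \<phi> v *\<^sub>C a"
proof -
  have "cbilinear (\<lambda>(a::'a) v. \<phi> v *\<^sub>C a)"
    by (rule cbilinearI) (simp_all add: clinearD[OF assms] scaleC_add_left scaleC_add_right scaleC_scaleC mult.commute scaleC_complex_def)
  then show "clinear (contraction \<phi> :: ('a, 'v) tensor \<Rightarrow> 'a)"
    and "contraction \<phi> (a \<otimes>\<^sub>C v) = \<phi> v *\<^sub>C a"
    unfolding contraction_def by (simp_all add: clinear_tensor_lift tensor_lift_pure)
qed

lemma contraction_in:
  assumes "clinear \<phi>" "csubspace S" "z \<in> tensor_subspace S W"
  shows "contraction \<phi> z \<in> S"
  by (rule clinear_tensor_subspace_in[OF clinear_contraction[OF assms(1)] assms(2,3)])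
     (simp add: contraction_pure[OF assms(1)] complex_vector.subspace_scale[OF assms(2)])

lemma contraction_zero:
  assumes "clinear \<phi>" "z \<in> tensor_subspace S W" "\<And>v. v \<in> W \<Longrightarrow> \<phi> v = 0"
  shows "contraction \<phi> z = 0"
proof -
  have "contraction \<phi> z \<in> {0}"
    by (rule clinear_tensor_subspace_in[OF clinear_contraction[OF assms(1)] complex_vector.subspace_single_0 assms(2)])
       (simp add: contraction_pure[OF assms(1)] assms(3))
  then show ?thesis by simp
qed

section \<open>Exactness in a given degree\<close>

text \<open>A single vector of \<open>Z\<close> outside \<open>B\<close> is independent modulo \<open>B\<close>, while a subset of \<open>B\<close> is
  independent modulo \<open>B\<close> only if it is empty.\<close>

lemma one_le_quotient_dim_iff:
  assumes "csubspace B"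
  shows "enat 1 \<le> quotient_dim Z B \<longleftrightarrow> \<not> Z \<subseteq> B"
proof
  assume dim: "enat 1 \<le> quotient_dim Z B"
  show "\<not> Z \<subseteq> B"
  proof
    assume "Z \<subseteq> B"
    have "S = {}" if "S \<subseteq> Z" "independent_mod B S" for S
    proof -
      have "(\<Sum>s\<in>S. 1 *\<^sub>C s) \<in> B"
        using that(1) \<open>Z \<subseteq> B\<close>
        by (intro complex_vector.subspace_sum[OF assms]) (auto simp: scaleC_one)
      with that(2)[unfolded independent_mod_def, rule_format, of "\<lambda>_. 1"] show ?thesis by auto
    qed
    then have "quotient_dim Z B \<le> 0"
      unfolding quotient_dim_def by (intro SUP_least) (force simp: zero_enat_def)
    then show False using order.trans[OF dim] by (force simp: zero_enat_def)
  qed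
next
  assume "\<not> Z \<subseteq> B"
  then obtain z where z: "z \<in> Z" "z \<notin> B" by blast
  have "c z = 0" if "c z *\<^sub>C z \<in> B" for c
  proof (rule ccontr)
    assume "c z \<noteq> 0"
    with complex_vector.subspace_scale[OF assms that, of "inverse (c z)"] z(2)
    show False by (simp add: scaleC_scaleC scaleC_one)
  qed
  with z have "{z} \<in> {S. finite S \<and> S \<subseteq> Z \<and> independent_mod B S}"
    by (auto simp: independent_mod_def)
  from SUP_upper[OF this, of "\<lambda>S. enat (card S)"]
  show "enat 1 \<le> quotient_dim Z B" by (simp add: quotient_dim_def)
qed

text \<open>The cochains one degree below \<open>i\<close>, with \<open>0\<close> below degree \<open>0\<close>; coboundaries are then images
  of these in every degree, which avoids a case distinction on the degree.\<close>

definition preceding :: "(nat \<Rightarrow> 't::zero set) \<Rightarrow> nat \<Rightarrow> 't set"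
  where "preceding C i = (case i of 0 \<Rightarrow> {0} | Suc j \<Rightarrow> C j)"

definition exact_at :: "(nat \<Rightarrow> 't::complex_vector set) \<Rightarrow> ('t \<Rightarrow> 't) \<Rightarrow> nat \<Rightarrow> bool"
  where "exact_at C D i \<longleftrightarrow> cocycles C D i \<subseteq> coboundaries C D i"

lemma coboundaries_eq_image:
  assumes "clinear D"
  shows "coboundaries C D i = D ` preceding C i"
  by (cases i) (simp_all add: coboundaries_def preceding_def clinearD(3)[OF assms])

lemma exact_at_iff:
  assumes "clinear D"
  shows "exact_at C D i \<longleftrightarrow> (\<forall>x\<in>C i. D x = 0 \<longrightarrow> x \<in> D ` preceding C i)"
  by (auto simp: exact_at_def cocycles_def coboundaries_eq_image[OF assms])

lemma preceding_tensor_degree: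
  fixes A :: "nat \<Rightarrow> 'a::complex_vector set"
  shows "preceding (tensor_degree A) k = tensor_subspace (preceding A k) (UNIV :: 'v::complex_vector set)"
proof (cases k)
  case 0
  have gens: "{a \<otimes>\<^sub>C v | (a :: 'a) (v :: 'v). a \<in> {0} \<and> v \<in> UNIV} = {0}"
    by (auto simp: tensor_zero_left)
  have "tensor_subspace {0 :: 'a} (UNIV :: 'v set) = {0}"
    unfolding tensor_subspace_def gens by simp
  with 0 show ?thesis by (simp add: preceding_def)
qed (simp add: preceding_def tensor_degree_eq)

lemma one_le_cohomology_dim_iff:
  assumes "clinear D" "csubspace (preceding C i)"
  shows "enat 1 \<le> cohomology_dim C D i \<longleftrightarrow> \<not> exact_at C D i"
proof -
  interpret D: Vector_Spaces.linear scaleC scaleC D by fact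
  have "csubspace (coboundaries C D i)"
    using D.subspace_image[OF assms(2)[unfolded csubspace_def]]
    by (simp add: coboundaries_eq_image[OF assms(1)] csubspace_def)
  then show ?thesis
    unfolding cohomology_dim_def exact_at_def by (rule one_le_quotient_dim_iff)
qed

section \<open>Twisted differentials\<close>

text \<open>The differential \<open>d \<otimes> id + \<eta> \<otimes> T\<close>, that is, \<open>d\<^sub>\<omega>\<close> for \<open>\<omega> = \<eta> \<otimes> g\<close> and \<open>T = \<theta> g\<close>.\<close>

definition twisted_diff ::
    "('a::complex_algebra_1 \<Rightarrow> 'a) \<Rightarrow> 'a \<Rightarrow> ('v::complex_vector \<Rightarrow> 'v) \<Rightarrow> ('a, 'v) tensor \<Rightarrow> ('a, 'v) tensor"
  where "twisted_diff d \<eta> T = tensor_lift (\<lambda>\<alpha> v. d \<alpha> \<otimes>\<^sub>C v + (\<eta> * \<alpha>) \<otimes>\<^sub>C T v)"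

lemma cov_diff_pure_connection:
  assumes "cbilinear \<theta>"
  shows "cov_diff d \<theta> (\<eta> \<otimes>\<^sub>C g) = twisted_diff d \<eta> (\<theta> g)"
  by (simp add: cov_diff_def twisted_diff_def tensor_lift_pure[OF cbilinear_mult_tensor(2)[OF assms]])

lemma
  fixes T :: "'v::complex_vector \<Rightarrow> 'v" and d :: "'a::complex_algebra_1 \<Rightarrow> 'a"
  assumes "clinear d" "clinear T"
  shows clinear_twisted_diff: "clinear (twisted_diff d \<eta> T)"
    and twisted_diff_pure: "twisted_diff d \<eta> T (\<alpha> \<otimes>\<^sub>C v) = d \<alpha> \<otimes>\<^sub>C v + (\<eta> * \<alpha>) \<otimes>\<^sub>C T v"
proof -
  have "cbilinear (\<lambda>\<alpha> v. d \<alpha> \<otimes>\<^sub>C v + (\<eta> * \<alpha>) \<otimes>\<^sub>C T v)"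
    by (rule cbilinearI)
       (simp_all add: clinearD(1,2)[OF assms(1)] clinearD(1,2)[OF assms(2)] distrib_left
          mult_scaleC_right cbilinearD[OF cbilinear_pure_tensor] scaleC_add_right)
  then show "clinear (twisted_diff d \<eta> T)"
    "twisted_diff d \<eta> T (\<alpha> \<otimes>\<^sub>C v) = d \<alpha> \<otimes>\<^sub>C v + (\<eta> * \<alpha>) \<otimes>\<^sub>C T v"
    unfolding twisted_diff_def by (simp_all add: clinear_tensor_lift tensor_lift_pure)
qed

locale closed_one_form = cdga A d
  for A :: "nat \<Rightarrow> 'a::complex_algebra_1 set" and d :: "'a \<Rightarrow> 'a" +
  fixes \<eta> :: 'a
  assumes degree_one: "\<eta> \<in> A 1" and closed: "d \<eta> = 0"
begin

text \<open>Graded commutativity gives \<open>\<eta> \<eta> = - \<eta> \<eta>\<close>, and \<open>2\<close> is invertible.\<close>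

lemma square_zero: "\<eta> * \<eta> = 0"
proof -
  have "\<eta> * \<eta> = - (\<eta> * \<eta>)" using graded_commute[OF degree_one degree_one] by simp
  then have "(1 + 1 :: complex) *\<^sub>C (\<eta> * \<eta>) = 0"
    by (simp only: scaleC_add_left scaleC_one) (simp add: eq_neg_iff_add_eq_0)
  then show ?thesis by simp
qed

lemma mult_square_zero: "\<eta> * (\<eta> * a) = 0"
  by (simp add: mult.assoc[symmetric] square_zero)

lemma d_mult: "d (\<eta> * a) = - (\<eta> * d a)"
  using leibniz[OF degree_one] by (simp add: closed)

lemma mult_preceding:
  assumes "a \<in> preceding A k" shows "\<eta> * a \<in> A k"
proof (cases k)
  case 0
  with assms show ?thesis using complex_vector.subspace_0[OF subspace] by (simp add: preceding_def)
next
  case (Suc j)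
  with assms mult_degree[OF degree_one, of a j] show ?thesis by (simp add: preceding_def)
qed

lemma csubspace_preceding: "csubspace (preceding A k)"
  by (cases k) (simp_all add: preceding_def subspace complex_vector.subspace_single_0)

text \<open>The differential on \<open>A\<close> itself attached to the rank one flat connection \<open>c \<eta>\<close>.\<close>

definition scalar_diff :: "complex \<Rightarrow> 'a \<Rightarrow> 'a"
  where "scalar_diff c a = d a + c *\<^sub>C (\<eta> * a)"

lemma clinear_scalar_diff: "clinear (scalar_diff c)"
  unfolding scalar_diff_def
  by (rule clinearI) (simp_all add: clinearD[OF diff_linear] distrib_left mult_scaleC_right
      scaleC_add_right scaleC_scaleC mult.commute)

lemma scalar_diff_mult: "scalar_diff c (\<eta> * a) = - (\<eta> * scalar_diff c a)"
  by (simp add: scalar_diff_def d_mult mult_square_zero distrib_left mult_scaleC_right)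

abbreviation twisted :: "('v::complex_vector \<Rightarrow> 'v) \<Rightarrow> ('a, 'v) tensor \<Rightarrow> ('a, 'v) tensor"
  where "twisted \<equiv> twisted_diff d \<eta>"

text \<open>The free parameter \<open>c\<close> splits \<open>T\<close> as \<open>c + (T - c)\<close>; when \<open>v\<close> is an eigenvector modulo some
  subspace \<open>W\<close>, the second summand lies in \<open>A \<otimes> W\<close>.\<close>

lemma twisted_pure:
  assumes "clinear T"
  shows "twisted T (a \<otimes>\<^sub>C v) = scalar_diff c a \<otimes>\<^sub>C v + (\<eta> * a) \<otimes>\<^sub>C (T v - c *\<^sub>C v)"
proof -
  have "(\<eta> * a) \<otimes>\<^sub>C T v = (\<eta> * a) \<otimes>\<^sub>C (T v - c *\<^sub>C v) + c *\<^sub>C ((\<eta> * a) \<otimes>\<^sub>C v)"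
    unfolding cbilinearD(3,4)[OF cbilinear_pure_tensor, symmetric] by simp
  then show ?thesis
    by (simp add: twisted_diff_pure[OF diff_linear assms] scalar_diff_def
        cbilinearD(1,2)[OF cbilinear_pure_tensor])
qed

text \<open>For \<open>\<phi>\<close> vanishing on the range of \<open>T - c\<close> the last term disappears, and \<open>\<phi>\<close> induces a chain
  map to \<open>(A, d + c \<eta>)\<close>. For arbitrary \<open>\<phi>\<close> the error term is a multiple of \<open>\<eta>\<close>, hence is killed by
  another multiplication with \<open>\<eta>\<close>.\<close>

lemma contraction_twisted:
  assumes T: "clinear T" and \<phi>: "clinear \<phi>"
  shows "contraction \<phi> (twisted T z) =
    scalar_diff c (contraction \<phi> z) + \<eta> * contraction (\<lambda>v. \<phi> (T v - c *\<^sub>C v)) z"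
proof (rule clinear_tensor_eqI[where z = z])
  note tw = clinearD[OF clinear_twisted_diff[OF diff_linear T]]
  note co = clinearD[OF clinear_contraction]
  note N = clinearD[OF clinear_diff_scale[OF T]]
  have \<phi>N: "clinear (\<lambda>v. \<phi> (T v - c *\<^sub>C v))"
    by (rule clinearI) (simp_all only: N clinearD[OF \<phi>])
  show "clinear (\<lambda>z. contraction \<phi> (twisted T z))"
    by (rule clinearI) (simp_all add: tw co[OF \<phi>])
  show "clinear (\<lambda>z. scalar_diff c (contraction \<phi> z) + \<eta> * contraction (\<lambda>v. \<phi> (T v - c *\<^sub>C v)) z)"
    by (rule clinearI) (simp_all only: co[OF \<phi>] co[OF \<phi>N] clinearD[OF clinear_scalar_diff]
        distrib_left mult_scaleC_right scaleC_add_right add_ac)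
  show "contraction \<phi> (twisted T (a \<otimes>\<^sub>C v)) =
    scalar_diff c (contraction \<phi> (a \<otimes>\<^sub>C v)) + \<eta> * contraction (\<lambda>v. \<phi> (T v - c *\<^sub>C v)) (a \<otimes>\<^sub>C v)" for a v
    by (simp only: twisted_pure[OF T, of _ _ c] co[OF \<phi>] contraction_pure[OF \<phi>] contraction_pure[OF \<phi>N]
       clinearD[OF clinear_scalar_diff] mult_scaleC_right)
qed

lemma twisted_twisted_pure:
  assumes T: "clinear T"
  shows "twisted T (twisted T (a \<otimes>\<^sub>C v)) = 0"
proof -
  note tw = clinearD[OF clinear_twisted_diff[OF diff_linear T]] twisted_diff_pure[OF diff_linear T]
  show ?thesis
    by (simp add: tw diff_diff d_mult mult_square_zero tensor_minus_left tensor_zero_left)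
qed

text \<open>An eigenvector \<open>v\<close> and a functional \<open>\<phi>\<close> with \<open>\<phi> \<circ> (T - c) = 0\<close> give chain maps into and out of
  \<open>A \<otimes> V\<close>, but their composite is \<open>\<phi> v\<close>, which is \<open>0\<close> as soon as \<open>v\<close> lies in the range of \<open>T - c\<close>.
  So exactness is used twice. Let \<open>D = d + c \<eta>\<close> and \<open>D x = 0\<close>. First, \<open>x \<otimes> v\<close> is a coboundary,
  which gives \<open>x = D a + \<eta> b\<close> and therefore \<open>\<eta> x = \<eta> D a = - D (\<eta> a)\<close>. Secondly, this is what is
  required to correct \<open>x \<otimes> w\<close>, with \<open>\<phi> w = 1\<close>, to a cocycle: the differential of \<open>x \<otimes> w\<close> is
  \<open>\<eta> x \<otimes> (T - c) w\<close>, and the correction is \<open>\<eta> a \<otimes> (T - c) w\<close>, whose own error term contains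
  \<open>\<eta> \<eta> = 0\<close>. This cocycle is a coboundary, and \<open>\<phi>\<close> maps it to \<open>x\<close>.\<close>

lemma exact_scalar_of_exact_tensor:
  fixes T :: "'v::complex_vector \<Rightarrow> 'v"
  assumes fd: "finite_dim (UNIV :: 'v set)" and T: "clinear T" and ev: "endo_eigenvalue T c"
    and exact: "exact_at (tensor_degree A) (twisted T) k"
  shows "exact_at A (scalar_diff c) k"
  unfolding exact_at_iff[OF clinear_scalar_diff]
proof (intro ballI impI)
  fix x assume x: "x \<in> A k" "scalar_diff c x = 0"
  note tw = clinearD[OF clinear_twisted_diff[OF diff_linear T]] twisted_pure[OF T, of _ _ c]
  note zero = tensor_zero_left tensor_zero_right
  have exact: "\<exists>y\<in>tensor_subspace (preceding A k) UNIV. twisted T y = z"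
    if "z \<in> tensor_subspace (A k) UNIV" "twisted T z = 0" for z
    using exact that unfolding exact_at_iff[OF clinear_twisted_diff[OF diff_linear T]]
      preceding_tensor_degree tensor_degree_eq by blast
  obtain v where v: "v \<noteq> 0" "T v = c *\<^sub>C v"
    using ev by (auto simp: endo_eigenvalue_def)
  obtain \<psi> :: "'v \<Rightarrow> complex" where \<psi>: "clinear \<psi>" "\<psi> v = 1"
    using separating_functional[OF complex_vector.subspace_single_0, of v] v(1) by blast
  have "twisted T (x \<otimes>\<^sub>C v) = 0"
    by (simp add: tw x(2) v(2) zero)
  then obtain y where y: "y \<in> tensor_subspace (preceding A k) UNIV" "twisted T y = x \<otimes>\<^sub>C v"
    using exact pure_in_tensor_subspace[OF x(1) UNIV_I] by blast
  define a where "a = contraction \<psi> y"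
  have a: "a \<in> preceding A k"
    unfolding a_def by (rule contraction_in[OF \<psi>(1) csubspace_preceding y(1)])
  have "x = scalar_diff c a + \<eta> * contraction (\<lambda>v. \<psi> (T v - c *\<^sub>C v)) y"
    using contraction_twisted[OF T \<psi>(1), of y c]
    by (simp add: y(2) contraction_pure[OF \<psi>(1)] \<psi>(2) scaleC_one a_def)
  then have \<eta>x: "\<eta> * x = \<eta> * scalar_diff c a"
    by (simp add: distrib_left mult_square_zero)
  obtain \<phi> :: "'v \<Rightarrow> complex" and w
    where \<phi>: "clinear \<phi>" "\<And>v. \<phi> (T v - c *\<^sub>C v) = 0" "\<phi> w = 1"
    using singular_endo_left_eigenfunctional[OF fd T ev] by blast
  let ?w' = "T w - c *\<^sub>C w"
  let ?z = "x \<otimes>\<^sub>C w + (\<eta> * a) \<otimes>\<^sub>C ?w'"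
  have "(\<eta> * x) \<otimes>\<^sub>C ?w' + scalar_diff c (\<eta> * a) \<otimes>\<^sub>C ?w' = 0"
    by (simp only: cbilinearD(1)[OF cbilinear_pure_tensor, symmetric] scalar_diff_mult \<eta>x zero right_minus)
  then have "twisted T ?z = 0"
    by (simp add: tw x(2) zero mult_square_zero)
  moreover have "?z \<in> tensor_subspace (A k) UNIV"
    by (intro tensor_subspace_add pure_in_tensor_subspace x(1) mult_preceding a UNIV_I)
  ultimately obtain y' where y': "y' \<in> tensor_subspace (preceding A k) UNIV" "twisted T y' = ?z"
    using exact by blast
  have "contraction (\<lambda>v. \<phi> (T v - c *\<^sub>C v)) y' = 0"
    by (rule contraction_zero[OF _ y'(1)]) (simp_all add: \<phi>(2) clinearI)
  moreover have "contraction \<phi> ?z = x"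
    by (simp add: clinearD[OF clinear_contraction[OF \<phi>(1)]] contraction_pure[OF \<phi>(1)] \<phi>(2,3) scaleC_one)
  ultimately have "scalar_diff c (contraction \<phi> y') = x"
    using contraction_twisted[OF T \<phi>(1), of y' c] y'(2) by simp
  moreover have "contraction \<phi> y' \<in> preceding A k"
    by (rule contraction_in[OF \<phi>(1) csubspace_preceding y'(1)])
  ultimately show "x \<in> scalar_diff c ` preceding A k" by blast
qed

text \<open>Along the triangular flag, a cocycle in \<open>A \<otimes> (W + \<complex> w)\<close> has a leading coefficient \<open>a\<close> at \<open>w\<close>,
  and \<open>a\<close> is a cocycle for \<open>d + c \<eta>\<close>, where \<open>c\<close> is the diagonal entry at \<open>w\<close>. Writing \<open>a\<close> as the
  coboundary of \<open>b\<close> and subtracting the differential of \<open>b \<otimes> w\<close> moves the cocycle into \<open>A \<otimes> W\<close>.\<close>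

lemma exact_tensor_of_exact_scalar:
  fixes T :: "'v::complex_vector \<Rightarrow> 'v"
  assumes fd: "finite_dim (UNIV :: 'v set)" and T: "clinear T"
    and exact: "\<And>c. endo_eigenvalue T c \<Longrightarrow> exact_at A (scalar_diff c) k"
  shows "exact_at (tensor_degree A) (twisted T) k"
proof -
  note tw = clinearD[OF clinear_twisted_diff[OF diff_linear T, of \<eta>]]
  \<comment> \<open>Only the cocycles are restricted to the members of the flag; the coboundaries are those of the
    whole complex, hence the name that hides \<open>UNIV\<close> from the induction.\<close>
  define Y where "Y = tensor_subspace (preceding A k) (UNIV :: 'v set)"
  let ?B = "twisted T ` Y"
  have "\<forall>z\<in>tensor_subspace (A k) (UNIV :: 'v set). twisted T z = 0 \<longrightarrow> z \<in> ?B"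
    using fd T
  proof (induction rule: triangular_induct)
    case zero
    have "id z \<in> {0}" if "z \<in> tensor_subspace (A k) {0 :: 'v}" for z
      by (rule clinear_tensor_subspace_in[OF _ _ that])
         (auto simp: tensor_zero_right intro: clinearI complex_vector.subspace_single_0)
    then show ?case
      using tw(3) tensor_subspace_zero unfolding Y_def by (metis id_apply image_eqI singletonD)
  next
    case (step W w c)
    show ?case
    proof (intro ballI impI)
      fix z assume z: "z \<in> tensor_subspace (A k) (cspan (insert w W))" "twisted T z = 0"
      obtain a z' where az: "a \<in> A k" "z' \<in> tensor_subspace (A k) W" "z = z' + a \<otimes>\<^sub>C w"
        by (rule tensor_subspace_insert[OF subspace z(1) step(1)])
      \<comment> \<open>\<open>\<phi>\<close> reads off the coefficient at \<open>w\<close>.\<close>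
      obtain \<phi> :: "'v \<Rightarrow> complex" where \<phi>: "clinear \<phi>" "\<And>x. x \<in> W \<Longrightarrow> \<phi> x = 0" "\<phi> w = 1"
        using separating_functional[OF step(1,3)] by blast
      have "twisted T z' \<in> tensor_subspace UNIV W"
        using step(2)
        by (intro clinear_tensor_subspace_in[OF clinear_twisted_diff[OF diff_linear T] csubspace_tensor_subspace az(2)])
           (auto simp: twisted_diff_pure[OF diff_linear T] intro!: tensor_subspace_add pure_in_tensor_subspace)
      then have "contraction \<phi> (twisted T z') = 0"
        by (rule contraction_zero[OF \<phi>(1) _ \<phi>(2)])
      moreover have "contraction \<phi> (twisted T z) = 0"
        by (simp add: z(2) clinearD(3)[OF clinear_contraction[OF \<phi>(1)]])
      ultimately have "contraction \<phi> (twisted T (a \<otimes>\<^sub>C w)) = 0"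
        by (simp add: az(3) tw(1) clinearD(1)[OF clinear_contraction[OF \<phi>(1)]])
      then have "scalar_diff c a = 0"
        by (simp add: twisted_pure[OF T, of _ _ c] clinearD(1)[OF clinear_contraction[OF \<phi>(1)]]
            contraction_pure[OF \<phi>(1)] \<phi>(2)[OF step(4)] \<phi>(3) scaleC_one)
      then obtain b where b: "b \<in> preceding A k" "a = scalar_diff c b"
        using exact[OF step(5)] az(1) unfolding exact_at_iff[OF clinear_scalar_diff] by blast
      have eq: "z - twisted T (b \<otimes>\<^sub>C w) = z' - (\<eta> * b) \<otimes>\<^sub>C (T w - c *\<^sub>C w)"
        by (simp add: az(3) b(2) twisted_pure[OF T, of _ _ c])
      have "z - twisted T (b \<otimes>\<^sub>C w) \<in> tensor_subspace (A k) W"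
        unfolding eq by (intro tensor_subspace_diff az(2) pure_in_tensor_subspace mult_preceding b(1) step(4))
      moreover have "twisted T (z - twisted T (b \<otimes>\<^sub>C w)) = 0"
        by (simp add: tw(4) z(2) twisted_twisted_pure[OF T])
      ultimately obtain y where y: "y \<in> Y"
          "z - twisted T (b \<otimes>\<^sub>C w) = twisted T y"
        using step(6) by blast
      have "z = twisted T (y + b \<otimes>\<^sub>C w)"
        using y(2) by (simp add: tw(1) algebra_simps)
      then show "z \<in> ?B"
        using tensor_subspace_add[OF y(1)[unfolded Y_def] pure_in_tensor_subspace[OF b(1) UNIV_I]]
        unfolding Y_def by blast
    qed
  qed
  then show ?thesis
    unfolding exact_at_iff[OF clinear_twisted_diff[OF diff_linear T]]
      preceding_tensor_degree tensor_degree_eq Y_def .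
qed

lemma exact_tensor_iff:
  fixes T :: "'v::complex_vector \<Rightarrow> 'v"
  assumes "finite_dim (UNIV :: 'v set)" "clinear T"
  shows "exact_at (tensor_degree A) (twisted T) k \<longleftrightarrow>
    (\<forall>c. endo_eigenvalue T c \<longrightarrow> exact_at A (scalar_diff c) k)"
  using exact_scalar_of_exact_tensor[OF assms] exact_tensor_of_exact_scalar[OF assms] by blast

section \<open>Resonance varieties\<close>

lemma pure_tensor_flat:
  assumes "lie_algebra br"
  shows "\<eta> \<otimes>\<^sub>C g \<in> flat_connections A d br"
proof -
  interpret lie_algebra br by fact
  have "\<eta> \<otimes>\<^sub>C g \<in> tensor_subspace (A 1) UNIV"
    by (rule pure_in_tensor_subspace[OF degree_one UNIV_I])
  then show ?thesis
    by (simp add: flat_connections_def tensor_degree_eq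
        tensor_diff_pure[OF diff_linear] tensor_bracket_pure[OF bilinear] closed square_zero tensor_zero_left)
qed

lemma pure_tensor_in_resonance_iff:
  assumes "lie_representation br \<theta>"
  shows "\<eta> \<otimes>\<^sub>C g \<in> resonance A d br \<theta> k 1 \<longleftrightarrow> \<not> exact_at (tensor_degree A) (twisted (\<theta> g)) k"
proof -
  interpret lie_representation br \<theta> by fact
  have T: "clinear (\<theta> g)" using rep_bilinear by (simp add: cbilinear_def)
  show ?thesis
    using one_le_cohomology_dim_iff[OF clinear_twisted_diff[OF diff_linear T],
        of "tensor_degree A" k \<eta>]
    by (simp add: resonance_def pure_tensor_flat lie_algebra_axioms cov_diff_pure_connection[OF rep_bilinear]
        preceding_tensor_degree csubspace_tensor_subspace)
qed

lemma closed_one_form_scale: "closed_one_form A d (c *\<^sub>C \<eta>)"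
  by unfold_locales
    (rule complex_vector.subspace_scale[OF subspace degree_one],
      simp add: clinearD(2)[OF diff_linear] closed)

text \<open>The rank one resonance varieties are defined through \<open>A \<otimes> \<complex>\<close>. The identification of this
  complex with \<open>A\<close>, as far as exactness is concerned, is the case \<open>V = \<complex>\<close>, \<open>T = 1\<close> of the criterion
  for exactness of \<open>A \<otimes> V\<close>, where \<open>1\<close> is the only eigenvalue.\<close>

lemma scale_in_resonance_rank_one_iff:
  "c *\<^sub>C \<eta> \<in> resonance_rank_one A d k 1 \<longleftrightarrow> \<not> exact_at A (scalar_diff c) k"
proof -
  interpret c: closed_one_form A d "c *\<^sub>C \<eta>" by (rule closed_one_form_scale)
  have fd: "finite_dim (UNIV :: complex set)"
    unfolding finite_dim_def
  proof (intro exI conjI)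
    have "x \<in> cspan {1}" for x :: complex
      using complex_vector.span_scale[OF complex_vector.span_base[of 1 "{1 :: complex}"], of x]
      by (simp add: scaleC_complex_def)
    then show "cspan {1} = (UNIV :: complex set)" by blast
  qed simp
  have lin: "clinear ((*) 1 :: complex \<Rightarrow> complex)"
    by (rule clinearI) (simp_all add: scaleC_complex_def)
  have ev: "endo_eigenvalue ((*) 1 :: complex \<Rightarrow> complex) l \<longleftrightarrow> l = 1" for l
    by (auto simp: endo_eigenvalue_def scaleC_complex_def intro: exI[of _ 1])
  have "c.scalar_diff 1 = scalar_diff c"
    by (simp add: fun_eq_iff c.scalar_diff_def scalar_diff_def mult_scaleC_left scaleC_one)
  then show ?thesis
    by (simp add: resonance_rank_one_def c.degree_one[simplified]
      c.pure_tensor_in_resonance_iff[OF lie_representation_complex, simplified]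
      c.exact_tensor_iff[OF fd lin, simplified] ev[simplified] )
qed

end

text \<open>If all cocycles are coboundaries, the only coset of the coboundaries is the zero class.\<close>

lemma (in cdga) not_exact_of_cohomology_nonzero:
  assumes "cohomology A d k \<noteq> {coboundaries A d k}"
  shows "\<not> exact_at A d k"
proof
  assume "exact_at A d k"
  then have sub: "cocycles A d k \<subseteq> coboundaries A d k" by (simp add: exact_at_def)
  have B: "coboundaries A d k = d ` preceding A k" by (rule coboundaries_eq_image[OF diff_linear])
  have "coboundaries A d k \<subseteq> cocycles A d k"
    unfolding B cocycles_def using diff_diff diff_degree complex_vector.subspace_0[OF subspace]
    by (cases k) (auto simp: preceding_def clinearD(3)[OF diff_linear])
  with sub have eq: "cocycles A d k = coboundaries A d k" by blast
  have diff: "x - y \<in> coboundaries A d k"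
    if "x \<in> coboundaries A d k" "y \<in> coboundaries A d k" for x y
    using that complex_vector.subspace_diff[OF subspace]
    unfolding eq[symmetric] cocycles_def by (auto simp: clinearD[OF diff_linear])
  have "0 \<in> coboundaries A d k"
    unfolding eq[symmetric] cocycles_def
    using complex_vector.subspace_0[OF subspace] by (simp add: clinearD[OF diff_linear])
  then have "cohomology A d k = {coboundaries A d k}"
    unfolding cohomology_def quotient_space_def eq quotient_def using diff by auto
  with assms show False by simp
qed

theorem theorem1p2:
  fixes A :: "nat \<Rightarrow> 'a::complex_algebra_1 set"
    and d :: "'a \<Rightarrow> 'a"
    and br :: "'g::complex_vector \<Rightarrow> 'g \<Rightarrow> 'g"
    and \<theta> :: "'g \<Rightarrow> 'v::complex_vector \<Rightarrow> 'v"
  assumes "one_finite_cdga A d"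
    and "lie_algebra br"
    and "finite_dim (UNIV :: 'g set)"
    and "lie_representation br \<theta>"
    and "finite_dim (UNIV :: 'v set)"
    and "(UNIV :: 'v set) \<noteq> {0}"
  shows "(\<forall>\<eta> g k. \<eta> \<in> A 1 \<longrightarrow> d \<eta> = 0 \<longrightarrow>
            (\<eta> \<otimes>\<^sub>C g \<in> resonance A d br \<theta> k 1 \<longleftrightarrow>
             (\<exists>c. endo_eigenvalue (\<theta> g) c \<and> c *\<^sub>C \<eta> \<in> resonance_rank_one A d k 1)))
       \<and> pi_locus A d \<theta> \<subseteq>
            (\<Inter>k\<in>{k. cohomology A d k \<noteq> {coboundaries A d k}}. resonance A d br \<theta> k 1)"
proof -
  interpret one_finite_cdga A d by fact
  have T: "clinear (\<theta> g)" for g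
    using assms(4) by (simp add: lie_representation_def lie_representation_axioms_def cbilinear_def)
  have iff: "\<eta> \<otimes>\<^sub>C g \<in> resonance A d br \<theta> k 1 \<longleftrightarrow>
      (\<exists>c. endo_eigenvalue (\<theta> g) c \<and> c *\<^sub>C \<eta> \<in> resonance_rank_one A d k 1)"
    if "\<eta> \<in> A 1" "d \<eta> = 0" for \<eta> g k
  proof -
    interpret closed_one_form A d \<eta> by unfold_locales (fact that)+
    show ?thesis
      unfolding pure_tensor_in_resonance_iff[OF assms(4)] scale_in_resonance_rank_one_iff
        exact_tensor_iff[OF assms(5) T] by blast
  qed
  have "\<eta> \<otimes>\<^sub>C g \<in> resonance A d br \<theta> k 1"
    if \<eta>: "\<eta> \<in> A 1" "d \<eta> = 0" and "endo_det (\<theta> g) = 0"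
      and k: "cohomology A d k \<noteq> {coboundaries A d k}" for \<eta> g k
  proof -
    interpret closed_one_form A d \<eta> by unfold_locales (fact \<eta>)+
    have "endo_eigenvalue (\<theta> g) 0"
      by (rule endo_det_zero_imp_eigenvalue_zero[OF assms(5) T that(3)])
    moreover have "scalar_diff 0 = d"
      by (simp add: fun_eq_iff scalar_diff_def)
    then have "0 *\<^sub>C \<eta> \<in> resonance_rank_one A d k 1"
      unfolding scale_in_resonance_rank_one_iff
      using not_exact_of_cohomology_nonzero[OF k] by simp
    ultimately show ?thesis unfolding iff[OF \<eta>] by blast
  qed
  then have "pi_locus A d \<theta> \<subseteq>
      (\<Inter>k\<in>{k. cohomology A d k \<noteq> {coboundaries A d k}}. resonance A d br \<theta> k 1)"
    unfolding pi_locus_def by blast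
  with iff show ?thesis by blast
qed

end
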